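(* Let $p$ be a prime. If $p=19$ or $p\geq 37$, there is no positive-definite integral ternary quadratic form that is coprime-universal with respect to $p$. If $p\in\{2,3,5,7,11,13,17\}$, there exists a positive-definite integral ternary quadratic form that is coprime-universal with respect to $p$. For $p=23,29,31$, such a form exists provided that the respective form $x^2+2xz+2y^2+3yz+5z^2$ (for $p=23$), $x^2+xz+2y^2+3yz+5z^2$ (for $p=29$), $x^2+2xz+2y^2+yz+5z^2$ (for $p=31$) is coprime-universal with respect to $p$.
   Context: A quadratic form $Q(x)=\frac12 x^tAx$ in $r$ variables is integral if $A$ is a symmetric integer matrix with even diagonal (equivalently, $Q$ has integer coefficients); ternary means $r=3$. $Q$ represents $n$ if $Q(x)=n$ for some $x\in\mathbb{Z}^r$. $Q$ is coprime-universal with respect to the prime $p$ if it represents every positive integer coprime to $p$. *)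

theory Defs
  imports "HOL-Analysis.Analysis" "HOL-Computational_Algebra.Primes"
begin

text \<open>Forms in \<open>r\<close> variables are functions on \<open>real ^ 'n\<close> with \<open>r = CARD('n)\<close>; ternary forms
  live on \<open>real ^ 3\<close>, with coordinates \<open>v $ 1\<close>, \<open>v $ 2\<close>, \<open>v $ 3\<close>.\<close>

definition integral_quadratic_form :: "(real ^ 'n \<Rightarrow> real) \<Rightarrow> bool" where
  "integral_quadratic_form Q \<longleftrightarrow>
     (\<exists>A :: int ^ 'n ^ 'n. transpose A = A \<and> (\<forall>i. even (A $ i $ i)) \<and>
        (\<forall>x. Q x = 1 / 2 * (x \<bullet> (map_matrix real_of_int A *v x))))"

definition positive_definite :: "(real ^ 'n \<Rightarrow> real) \<Rightarrow> bool" where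
  "positive_definite Q \<longleftrightarrow> (\<forall>x. x \<noteq> 0 \<longrightarrow> Q x > 0)"

definition represents :: "(real ^ 'n \<Rightarrow> real) \<Rightarrow> int \<Rightarrow> bool" where
  "represents Q n \<longleftrightarrow> (\<exists>x :: int ^ 'n. Q (\<chi> i. real_of_int (x $ i)) = real_of_int n)"

definition coprime_universal :: "nat \<Rightarrow> (real ^ 'n \<Rightarrow> real) \<Rightarrow> bool" where
  "coprime_universal p Q \<longleftrightarrow> (\<forall>n > 0. coprime n (int p) \<longrightarrow> represents Q n)"

end

theory Submission
  imports Defs "HOL-Number_Theory.Number_Theory" "HOL-Computational_Algebra.Squarefree"
begin

text \<open>Nonexistence: a form representing \<open>1\<close> and \<open>2\<close> reduces to \<open>x\<^sup>2 + f x y + b y\<^sup>2 + \<dots>\<close> with one of four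
  binary sections, and representing the least integer missed by the section bounds the discriminant.
  Each of the finitely many forms left misses some \<open>n \<le> 31\<close> other than \<open>19\<close>.

  Existence: for \<open>p = 2, 3, 5, 7, 11, 13, 17\<close> every form of half-discriminant \<open>p\<close> is
  equivalent to one representative, except that \<open>p = 11, 17\<close> have a second class, whose values the
  first class also takes.  So it suffices to represent each squarefree \<open>n\<close> prime to \<open>p\<close> by some form of
  half-discriminant \<open>p\<close>.  Such a form exists as soon as there is an \<open>\<alpha>\<close> prime to \<open>2 n p\<close> such that \<open>-\<alpha>\<close>
  is a square modulo \<open>4 n\<close> and \<open>-n p\<close> is a square modulo \<open>\<alpha>\<close>.  Instead of taking a prime \<open>\<alpha>\<close> from
  Dirichlet's theorem, one takes the squarefree part of an \<open>m\<close> in a suitable residue class with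
  \<open>\<Sum>d dvd m. \<psi> d > 0\<close>, where \<open>\<psi>\<close> is the character of \<open>\<rat>(\<surd>(-n p))\<close>; a hyperbola argument
  provides \<open>m\<close>.\<close>

section \<open>Reduction of ternary forms\<close>

text \<open>Every integer on the list of missed values is at most 31 and none is divisible by 19, so
  one list settles both \<open>p = 19\<close> and \<open>p \<ge> 37\<close>. In the existence half,
  a class of \<open>m\<close> that is -1 modulo \<open>4 n\<close> makes \<open>-m\<close> a square
  there. This fixes every factor of \<open>\<psi> m\<close> except the one at \<open>p\<close>, and
  that last freedom is spent on making \<open>\<psi>\<close> equal to 1 on the class: an \<alpha>
  composed only of primes with \<open>\<psi> q = 1\<close> has \<open>\<psi> \<alpha> = 1\<close>,
  so no other class could contain one. The sum of \<open>\<psi>\<close> over the divisors of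
  \<open>m\<close> is a product over the primes of \<open>m\<close>, and a prime with
  \<open>\<psi> q = -1\<close> and odd multiplicity contributes the factor 0. Positivity of the sum
  thus clears such primes from the squarefree part, which may have many prime factors: the square
  roots of \<open>- n p\<close> modulo them are glued by the Chinese remainder theorem. Since the
  sum is also nonnegative everywhere and at least 1 on squares, it can be bounded from below on
  average.\<close>

datatype ternary = Ternary (cxx: int) (cyy: int) (czz: int) (cyz: int) (cxz: int) (cxy: int)

primrec value_at :: "ternary \<Rightarrow> int \<Rightarrow> int \<Rightarrow> int \<Rightarrow> int" where
  "value_at (Ternary a b c d e f) x y z =
     a * x^2 + b * y^2 + c * z^2 + d * y * z + e * x * z + f * x * y"

text \<open>Half the determinant of the even integer matrix \<open>A\<close> of the form.\<close>

primrec half_disc :: "ternary \<Rightarrow> int" where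
  "half_disc (Ternary a b c d e f) = 4 * a * b * c + d * e * f - a * d^2 - b * e^2 - c * f^2"

text \<open>Leaving out the zero vector makes positive definiteness a property of this set
  alone.\<close>

definition nonzero_values :: "ternary \<Rightarrow> int set" where
  "nonzero_values t = {value_at t x y z | x y z. (x, y, z) \<noteq> (0, 0, 0)}"

lemma nonzero_valuesI:
  "n = value_at t x y z \<Longrightarrow> (x, y, z) \<noteq> (0, 0, 0) \<Longrightarrow> n \<in> nonzero_values t"
  by (auto simp: nonzero_values_def)

text \<open>An invariant substitute for equivalence: it is all that the reduction has to preserve.\<close>

definition similar :: "ternary \<Rightarrow> ternary \<Rightarrow> bool" where
  "similar s t \<longleftrightarrow> half_disc s = half_disc t \<and> nonzero_values s = nonzero_values t"

lemma similar_refl [simp]: "similar t t"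
  by (simp add: similar_def)

lemma similar_trans [trans]: "similar r s \<Longrightarrow> similar s t \<Longrightarrow> similar r t"
  by (simp add: similar_def)

lemma similar_substitution:
  assumes "half_disc s = half_disc t"
    and "\<And>x y z. value_at s x y z = value_at t (F x y z) (G x y z) (H x y z)"
    and "\<And>x y z. value_at t x y z = value_at s (F' x y z) (G' x y z) (H' x y z)"
    and "\<And>x y z. F x y z = 0 \<Longrightarrow> G x y z = 0 \<Longrightarrow> H x y z = 0 \<Longrightarrow> x = 0 \<and> y = 0 \<and> z = 0"
    and "\<And>x y z. F' x y z = 0 \<Longrightarrow> G' x y z = 0 \<Longrightarrow> H' x y z = 0 \<Longrightarrow> x = 0 \<and> y = 0 \<and> z = 0"
  shows "similar s t"
  unfolding similar_def
proof (intro conjI equalityI subsetI)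
  fix n assume "n \<in> nonzero_values s"
  then obtain x y z where n: "n = value_at s x y z" "(x, y, z) \<noteq> (0, 0, 0)"
    by (auto simp: nonzero_values_def)
  show "n \<in> nonzero_values t"
    by (rule nonzero_valuesI[where x = "F x y z" and y = "G x y z" and z = "H x y z"])
      (use n assms(2,4)[of x y z] in auto)
next
  fix n assume "n \<in> nonzero_values t"
  then obtain x y z where n: "n = value_at t x y z" "(x, y, z) \<noteq> (0, 0, 0)"
    by (auto simp: nonzero_values_def)
  show "n \<in> nonzero_values s"
    by (rule nonzero_valuesI[where x = "F' x y z" and y = "G' x y z" and z = "H' x y z"])
      (use n assms(3,5)[of x y z] in auto)
qed (fact assms(1))

lemma similar_swap_xy: "similar (Ternary b a c e d f) (Ternary a b c d e f)"
  by (rule similar_substitution[where F = "\<lambda>x y z. y" and G = "\<lambda>x y z. x" and H = "\<lambda>x y z. z"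
        and F' = "\<lambda>x y z. y" and G' = "\<lambda>x y z. x" and H' = "\<lambda>x y z. z"]) (auto simp: algebra_simps)

lemma similar_swap_yz: "similar (Ternary a c b d f e) (Ternary a b c d e f)"
  by (rule similar_substitution[where F = "\<lambda>x y z. x" and G = "\<lambda>x y z. z" and H = "\<lambda>x y z. y"
        and F' = "\<lambda>x y z. x" and G' = "\<lambda>x y z. z" and H' = "\<lambda>x y z. y"]) (auto simp: algebra_simps)

lemma similar_neg_x: "similar (Ternary a b c d (- e) (- f)) (Ternary a b c d e f)"
  by (rule similar_substitution[where F = "\<lambda>x y z. - x" and G = "\<lambda>x y z. y" and H = "\<lambda>x y z. z"
        and F' = "\<lambda>x y z. - x" and G' = "\<lambda>x y z. y" and H' = "\<lambda>x y z. z"]) (auto simp: algebra_simps)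

lemma similar_neg_z: "similar (Ternary a b c (- d) (- e) f) (Ternary a b c d e f)"
  by (rule similar_substitution[where F = "\<lambda>x y z. x" and G = "\<lambda>x y z. y" and H = "\<lambda>x y z. - z"
        and F' = "\<lambda>x y z. x" and G' = "\<lambda>x y z. y" and H' = "\<lambda>x y z. - z"]) (auto simp: algebra_simps)

lemma similar_shift_xy:
  "similar (Ternary a (b + a * k^2 + f * k) c (d + e * k) e (f + 2 * a * k)) (Ternary a b c d e f)"
  by (rule similar_substitution[where F = "\<lambda>x y z. x + k * y" and G = "\<lambda>x y z. y" and H = "\<lambda>x y z. z"
        and F' = "\<lambda>x y z. x - k * y" and G' = "\<lambda>x y z. y" and H' = "\<lambda>x y z. z"])
    (auto simp: algebra_simps power2_eq_square)

lemma similar_shift_xz: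
  "similar (Ternary a b (c + a * k^2 + e * k) (d + f * k) (e + 2 * a * k) f) (Ternary a b c d e f)"
  by (rule similar_substitution[where F = "\<lambda>x y z. x + k * z" and G = "\<lambda>x y z. y" and H = "\<lambda>x y z. z"
        and F' = "\<lambda>x y z. x - k * z" and G' = "\<lambda>x y z. y" and H' = "\<lambda>x y z. z"])
    (auto simp: algebra_simps power2_eq_square)

lemma similar_shift_yz:
  "similar (Ternary a b (c + b * k^2 + d * k) (d + 2 * b * k) (e + f * k) f) (Ternary a b c d e f)"
  by (rule similar_substitution[where F = "\<lambda>x y z. x" and G = "\<lambda>x y z. y + k * z" and H = "\<lambda>x y z. z"
        and F' = "\<lambda>x y z. x" and G' = "\<lambda>x y z. y - k * z" and H' = "\<lambda>x y z. z"])
    (auto simp: algebra_simps power2_eq_square)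

section \<open>Positive definite forms and completed squares\<close>

definition pos_def :: "ternary \<Rightarrow> bool" where
  "pos_def t \<longleftrightarrow> (\<forall>n \<in> nonzero_values t. 0 < n)"

lemma pos_def_similar: "pos_def t \<Longrightarrow> similar s t \<Longrightarrow> pos_def s"
  by (simp add: pos_def_def similar_def)

lemma pos_defD: "pos_def t \<Longrightarrow> (x, y, z) \<noteq> (0, 0, 0) \<Longrightarrow> 0 < value_at t x y z"
  unfolding pos_def_def by (meson nonzero_valuesI)

lemma pos_def_xx: "pos_def (Ternary a b c d e f) \<Longrightarrow> 0 < a"
  using pos_defD[of "Ternary a b c d e f" 1 0 0] by simp

lemma pos_def_minor:
  assumes "pos_def (Ternary a b c d e f)" shows "0 < 4 * a * b - f^2"
proof -
  have a: "0 < a" using pos_def_xx[OF assms] .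
  \<comment> \<open>In the plane \<open>z = 0\<close> this vector annihilates the linear form
    \<open>2 a x + f y + e z\<close>.\<close>
  have "value_at (Ternary a b c d e f) (- f) (2 * a) 0 = a * (4 * a * b - f^2)"
    by (simp add: algebra_simps power2_eq_square)
  then have "0 < a * (4 * a * b - f^2)"
    using pos_defD[OF assms, of "- f" "2 * a" 0] a by force
  with a show ?thesis
    by (metis zero_less_mult_pos)
qed

lemma value_at_complete_x:
  "4 * a * value_at (Ternary a b c d e f) x y z =
     (2 * a * x + f * y + e * z)^2 + (4 * a * b - f^2) * y^2
       + 2 * (2 * a * d - e * f) * y * z + (4 * a * c - e^2) * z^2"
  by (simp add: algebra_simps power2_eq_square)

lemma value_at_complete_xy:
  "4 * a * (4 * a * b - f^2) * value_at (Ternary a b c d e f) x y z =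
     (4 * a * b - f^2) * (2 * a * x + f * y + e * z)^2
       + ((4 * a * b - f^2) * y + (2 * a * d - e * f) * z)^2
       + 4 * a * half_disc (Ternary a b c d e f) * z^2"
  by (simp add: algebra_simps power2_eq_square)

text \<open>Sylvester's determinant identity for the matrix \<open>A\<close> with pivot
  \<open>2 a\<close>: the 2 x 2 minors containing the pivot have determinant
  \<open>2 a * det A\<close>.\<close>

lemma minor_determinant:
  "(4 * a * b - f^2) * (4 * a * c - e^2) - (2 * a * d - e * f)^2 = 4 * a * half_disc (Ternary a b c d e f)"
  by (simp add: algebra_simps power2_eq_square)

lemma shift_into_symmetric_interval:
  fixes m r :: int assumes "0 < m" obtains k where "\<bar>2 * (r + m * k)\<bar> \<le> m"
proof -
  define k where "k = - ((2 * r + m) div (2 * m))"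
  have "(2 * r + m) = 2 * m * ((2 * r + m) div (2 * m)) + (2 * r + m) mod (2 * m)" by simp
  moreover have "0 \<le> (2 * r + m) mod (2 * m)" "(2 * r + m) mod (2 * m) < 2 * m" using assms by auto
  ultimately have "\<bar>2 * (r + m * k)\<bar> \<le> m" unfolding k_def by (simp add: algebra_simps abs_le_iff)
  then show thesis using that by blast
qed

text \<open>Hermite reduction: \<open>4 a Q = (2 a x + f y + e z)\<^sup>2 + G(y, z)\<close>, and the binary form \<open>G\<close> with
  coefficients \<open>4 a b - f\<^sup>2\<close>, \<open>2 (2 a d - e f)\<close>, \<open>4 a c - e\<^sup>2\<close> is reduced in the sense of Gauss.\<close>

definition reduced :: "ternary \<Rightarrow> bool" where
  "reduced t \<longleftrightarrow> (case t of Ternary a b c d e f \<Rightarrow>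
     0 \<le> f \<and> f \<le> a \<and> 0 \<le> e \<and> e \<le> a \<and> a \<le> b \<and>
     \<bar>2 * (2 * a * d - e * f)\<bar> \<le> 4 * a * b - f^2 \<and> 4 * a * b - f^2 \<le> 4 * a * c - e^2)"

text \<open>The order of the normalisations matters. Shifting \<open>y\<close> by a multiple of
  \<open>z\<close> reduces the middle coefficient of \<open>G\<close>; shifting \<open>x\<close> by
  multiples of \<open>y\<close> and \<open>z\<close> afterwards leaves \<open>G\<close> alone and
  makes \<open>f\<close> and \<open>e\<close> small; sign changes come last. The inequality
  \<open>a \<le> b\<close> holds because exchanging \<open>x\<close> and \<open>y\<close> cannot
  beat the minimal \<open>a\<close>, and the one between the outer coefficients of \<open>G\<close>
  because exchanging \<open>y\<close> and \<open>z\<close> cannot beat the minimal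
  \<open>4 a b - f^2\<close>.\<close>

theorem exists_reduced:
  assumes "pos_def t" obtains s where "similar s t" "reduced s"
proof -
  txt \<open>First minimise \<open>a\<close>, then \<open>4 a b - f\<^sup>2\<close>.\<close>
  define A where "A = (\<lambda>n. \<exists>a b c d e f. similar (Ternary a b c d e f) t \<and> n = nat a)"
  have "A (nat (cxx t))"
    unfolding A_def by (cases t) (metis similar_refl ternary.sel(1))
  then have LA: "A (LEAST n. A n)" by (rule LeastI)
  define n0 where "n0 = (LEAST n. A n)"
  define M where "M = (\<lambda>n. \<exists>a b c d e f. similar (Ternary a b c d e f) t \<and> n0 = nat a \<and> n = nat (4 * a * b - f^2))"
  from LA have "\<exists>n. M n" unfolding A_def M_def n0_def by blast
  then have LM: "M (LEAST n. M n)" by (metis LeastI)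
  then obtain a b0 c0 d0 e0 f0 where s0: "similar (Ternary a b0 c0 d0 e0 f0) t"
    and a: "n0 = nat a" and al0: "(LEAST n. M n) = nat (4 * a * b0 - f0^2)"
    unfolding M_def by blast
  have pd: "pos_def s" if "similar s t" for s using pos_def_similar[OF assms that] .
  have apos: "0 < a" using pos_def_xx[OF pd[OF s0]] .
  have amin: "a \<le> a'" if "similar (Ternary a' b c d e f) t" for a' b c d e f
  proof -
    have "A (nat a')" unfolding A_def using that by blast
    then have "n0 \<le> nat a'" unfolding n0_def by (rule Least_le)
    with a pos_def_xx[OF pd[OF that]] show ?thesis by simp
  qed
  have almin: "4 * a * b0 - f0^2 \<le> 4 * a * b - f^2" if "similar (Ternary a b c d e f) t" for b c d e f
  proof -
    have "M (nat (4 * a * b - f^2))" unfolding M_def using that a by blast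
    then have "nat (4 * a * b0 - f0^2) \<le> nat (4 * a * b - f^2)" unfolding al0[symmetric] by (rule Least_le)
    with pos_def_minor[OF pd[OF that]] show ?thesis by simp
  qed
  define al where "al = 4 * a * b0 - f0^2"
  have alpos: "0 < al" using pos_def_minor[OF pd[OF s0]] by (simp add: al_def)
  obtain k where k: "\<bar>2 * ((2 * a * d0 - e0 * f0) + al * k)\<bar> \<le> al"
    using shift_into_symmetric_interval[OF alpos] .
  obtain c1 d1 e1 where s1: "similar (Ternary a b0 c1 d1 e1 f0) t"
    and be1: "\<bar>2 * (2 * a * d1 - e1 * f0)\<bar> \<le> al"
  proof
    show "similar (Ternary a b0 (c0 + b0 * k^2 + d0 * k) (d0 + 2 * b0 * k) (e0 + f0 * k) f0) t"
      using similar_shift_yz s0 by (rule similar_trans)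
    have "2 * a * (d0 + 2 * b0 * k) - (e0 + f0 * k) * f0 = (2 * a * d0 - e0 * f0) + al * k"
      by (simp add: al_def algebra_simps power2_eq_square)
    with k show "\<bar>2 * (2 * a * (d0 + 2 * b0 * k) - (e0 + f0 * k) * f0)\<bar> \<le> al" by simp
  qed
  have "0 < 2 * a" using apos by simp
  then obtain k where k: "\<bar>2 * (f0 + 2 * a * k)\<bar> \<le> 2 * a"
    using shift_into_symmetric_interval by blast
  obtain b2 d2 f2 where s2: "similar (Ternary a b2 c1 d2 e1 f2) t" and f2: "\<bar>f2\<bar> \<le> a"
    and be2: "\<bar>2 * (2 * a * d2 - e1 * f2)\<bar> \<le> al" and al2: "4 * a * b2 - f2^2 = al"
  proof
    show "similar (Ternary a (b0 + a * k^2 + f0 * k) c1 (d1 + e1 * k) e1 (f0 + 2 * a * k)) t"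
      using similar_shift_xy s1 by (rule similar_trans)
    show "\<bar>f0 + 2 * a * k\<bar> \<le> a" using k by simp
    have "2 * a * (d1 + e1 * k) - e1 * (f0 + 2 * a * k) = 2 * a * d1 - e1 * f0"
      by (simp add: algebra_simps)
    with be1 show "\<bar>2 * (2 * a * (d1 + e1 * k) - e1 * (f0 + 2 * a * k))\<bar> \<le> al" by simp
    show "4 * a * (b0 + a * k^2 + f0 * k) - (f0 + 2 * a * k)^2 = al"
      by (simp add: al_def algebra_simps power2_eq_square)
  qed
  from \<open>0 < 2 * a\<close> obtain k where k: "\<bar>2 * (e1 + 2 * a * k)\<bar> \<le> 2 * a"
    using shift_into_symmetric_interval by blast
  obtain c3 d3 e3 where s3: "similar (Ternary a b2 c3 d3 e3 f2) t" and e3: "\<bar>e3\<bar> \<le> a"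
    and be3: "\<bar>2 * (2 * a * d3 - e3 * f2)\<bar> \<le> al"
  proof
    show "similar (Ternary a b2 (c1 + a * k^2 + e1 * k) (d2 + f2 * k) (e1 + 2 * a * k) f2) t"
      using similar_shift_xz s2 by (rule similar_trans)
    show "\<bar>e1 + 2 * a * k\<bar> \<le> a" using k by simp
    have "2 * a * (d2 + f2 * k) - (e1 + 2 * a * k) * f2 = 2 * a * d2 - e1 * f2"
      by (simp add: algebra_simps)
    with be2 show "\<bar>2 * (2 * a * (d2 + f2 * k) - (e1 + 2 * a * k) * f2)\<bar> \<le> al" by simp
  qed
  obtain d4 e4 f4 where s4: "similar (Ternary a b2 c3 d4 e4 f4) t" and e4: "\<bar>e4\<bar> \<le> a"
    and f4: "0 \<le> f4" "f4 \<le> a" and be4: "\<bar>2 * (2 * a * d4 - e4 * f4)\<bar> \<le> al" and al4: "4 * a * b2 - f4^2 = al"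
  proof (cases "0 \<le> f2")
    case True
    then show thesis using that s3 e3 f2 be3 al2 by auto
  next
    case False
    have "similar (Ternary a b2 c3 d3 (- e3) (- f2)) t"
      using similar_neg_x s3 by (rule similar_trans)
    then show thesis using that[of d3 "- e3" "- f2"] False e3 f2 be3 al2 by auto
  qed
  obtain d5 e5 where s5: "similar (Ternary a b2 c3 d5 e5 f4) t" and e5: "0 \<le> e5" "e5 \<le> a"
    and be5: "\<bar>2 * (2 * a * d5 - e5 * f4)\<bar> \<le> al"
  proof (cases "0 \<le> e4")
    case True
    then show thesis using that s4 e4 be4 by auto
  next
    case False
    have "similar (Ternary a b2 c3 (- d4) (- e4) f4) t"
      using similar_neg_z s4 by (rule similar_trans)
    then show thesis using that[of "- d4" "- e4"] False e4 be4 by (auto simp: abs_if split: if_splits)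
  qed
  have "similar (Ternary b2 a c3 e5 d5 f4) t" using similar_swap_xy s5 by (rule similar_trans)
  then have "a \<le> b2" by (rule amin)
  moreover have "similar (Ternary a c3 b2 d5 f4 e5) t" using similar_swap_yz s5 by (rule similar_trans)
  then have "al \<le> 4 * a * c3 - e5^2" unfolding al_def by (rule almin)
  ultimately have "reduced (Ternary a b2 c3 d5 e5 f4)"
    using f4 e5 be5 al4 by (simp add: reduced_def)
  with s5 show thesis using that by blast
qed

section \<open>Inequalities for reduced forms\<close>

lemma reduced_minor_bounds:
  assumes "pos_def (Ternary a b c d e f)" "reduced (Ternary a b c d e f)"
  shows "3 * a^2 \<le> 4 * a * b - f^2"
    and "3 * (4 * a * b - f^2)^2 \<le> 16 * a * half_disc (Ternary a b c d e f)"
proof -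
  have a: "0 < a" using pos_def_xx[OF assms(1)] .
  have r: "0 \<le> f" "f \<le> a" "a \<le> b" "\<bar>2 * (2 * a * d - e * f)\<bar> \<le> 4 * a * b - f^2"
    "4 * a * b - f^2 \<le> 4 * a * c - e^2"
    using assms(2) by (auto simp: reduced_def)
  have "f^2 \<le> a^2" using r by (intro power_mono) auto
  moreover have "a * a \<le> a * b" using a r by (intro mult_left_mono) auto
  ultimately show "3 * a^2 \<le> 4 * a * b - f^2" by (simp add: power2_eq_square)
  define al be ga where "al = 4 * a * b - f^2" and "be = 2 * a * d - e * f" and "ga = 4 * a * c - e^2"
  have al: "0 < al" using pos_def_minor[OF assms(1)] by (simp add: al_def)
  have "(2 * be)^2 \<le> al^2"
    using r al unfolding al_def[symmetric] be_def[symmetric] by (metis abs_le_square_iff abs_of_pos)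
  moreover have "al * al \<le> al * ga" using r al unfolding al_def ga_def by (intro mult_left_mono) auto
  moreover have "al * ga - be^2 = 4 * a * half_disc (Ternary a b c d e f)"
    unfolding al_def be_def ga_def by (rule minor_determinant)
  ultimately have "3 * al^2 \<le> 16 * a * half_disc (Ternary a b c d e f)"
    by (simp add: power2_eq_square algebra_simps)
  then show "3 * (4 * a * b - f^2)^2 \<le> 16 * a * half_disc (Ternary a b c d e f)" by (simp add: al_def)
qed

text \<open>Among reduced binary forms with a given leading coefficient, the hexagonal one is
  extremal: the middle coefficient is as large and the last one as small as reduction
  permits.\<close>

lemma reduced_binary_ge:
  assumes "pos_def (Ternary a b c d e f)" "reduced (Ternary a b c d e f)"
  shows "(4 * a * b - f^2) * (y^2 - \<bar>y * z\<bar> + z^2)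
      \<le> (4 * a * b - f^2) * y^2 + 2 * (2 * a * d - e * f) * y * z + (4 * a * c - e^2) * z^2"
proof -
  define al be ga where "al = 4 * a * b - f^2" and "be = 2 * a * d - e * f" and "ga = 4 * a * c - e^2"
  have al: "0 < al" using pos_def_minor[OF assms(1)] by (simp add: al_def)
  have r: "\<bar>2 * be\<bar> \<le> al" "al \<le> ga" using assms(2) by (auto simp: reduced_def al_def be_def ga_def)
  have "- (al * \<bar>y * z\<bar>) \<le> 2 * be * y * z"
  proof -
    have "\<bar>2 * be\<bar> * \<bar>y * z\<bar> \<le> al * \<bar>y * z\<bar>" using r by (intro mult_right_mono) auto
    then show ?thesis by (simp add: abs_mult[symmetric] mult.assoc abs_le_iff)
  qed
  moreover have "al * z^2 \<le> ga * z^2" using r by (intro mult_right_mono) auto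
  ultimately show ?thesis
    unfolding al_def[symmetric] be_def[symmetric] ga_def[symmetric] by (simp add: algebra_simps)
qed

lemma reduced_value_ge:
  assumes "pos_def (Ternary a b c d e f)" "reduced (Ternary a b c d e f)"
  shows "(4 * a * b - f^2) * (y^2 - \<bar>y * z\<bar> + z^2) \<le> 4 * a * value_at (Ternary a b c d e f) x y z"
  using reduced_binary_ge[OF assms, of y z] unfolding value_at_complete_x
  by (smt (verit) zero_le_power2)

lemma hexagonal_norm_ge:
  fixes y z :: int
  shows "3 * y^2 \<le> 4 * (y^2 - \<bar>y * z\<bar> + z^2)" "3 * z^2 \<le> 4 * (y^2 - \<bar>y * z\<bar> + z^2)"
proof -
  have "0 \<le> (\<bar>y\<bar> - 2 * \<bar>z\<bar>)^2" "0 \<le> (2 * \<bar>y\<bar> - \<bar>z\<bar>)^2" by simp_all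
  then show "3 * y^2 \<le> 4 * (y^2 - \<bar>y * z\<bar> + z^2)" "3 * z^2 \<le> 4 * (y^2 - \<bar>y * z\<bar> + z^2)"
    by (simp_all add: power2_diff abs_mult power_mult_distrib algebra_simps)
qed

lemma hexagonal_norm_ge_1:
  fixes y z :: int
  assumes "(y, z) \<noteq> (0, 0)"
  shows "1 \<le> y^2 - \<bar>y * z\<bar> + z^2"
proof -
  define H where "H = y^2 - \<bar>y * z\<bar> + z^2"
  have "3 * y^2 \<le> 4 * H" "3 * z^2 \<le> 4 * H" "0 < y^2 \<or> 0 < z^2"
    using hexagonal_norm_ge(1)[of y z] hexagonal_norm_ge(2)[of z y] assms by (auto simp: H_def)
  then show ?thesis unfolding H_def[symmetric] by (smt (verit))
qed

lemma reduced_minor_le_value: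
  assumes "pos_def (Ternary a b c d e f)" "reduced (Ternary a b c d e f)" "(y, z) \<noteq> (0, 0)"
  shows "4 * a * b - f^2 \<le> 4 * a * value_at (Ternary a b c d e f) x y z"
proof -
  have "(4 * a * b - f^2) * 1 \<le> (4 * a * b - f^2) * (y^2 - \<bar>y * z\<bar> + z^2)"
    using hexagonal_norm_ge_1[OF assms(3)] pos_def_minor[OF assms(1)] by (intro mult_left_mono) auto
  with reduced_value_ge[OF assms(1,2), of y z x] show ?thesis by simp
qed

lemma half_disc_pos:
  assumes "pos_def (Ternary a b c d e f)"
  shows "0 < half_disc (Ternary a b c d e f)"
proof -
  define al be where "al = 4 * a * b - f^2" and "be = 2 * a * d - e * f"
  have a: "0 < a" using pos_def_xx[OF assms] .
  have al: "0 < al" using pos_def_minor[OF assms] by (simp add: al_def)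
  \<comment> \<open>This vector annihilates both linear forms in
    \<open>value_at_complete_xy\<close>, so only the discriminant term survives.\<close>
  let ?x = "be * f - e * al" and ?y = "- 2 * a * be" and ?z = "2 * a * al"
  have "0 < value_at (Ternary a b c d e f) ?x ?y ?z"
    using assms by (rule pos_defD) (use a al in auto)
  then have "0 < 4 * a * al * value_at (Ternary a b c d e f) ?x ?y ?z"
    using a al by (intro mult_pos_pos) auto
  also have "\<dots> = 4 * a * half_disc (Ternary a b c d e f) * ?z^2"
    unfolding al_def value_at_complete_xy by (simp add: be_def algebra_simps power2_eq_square)
  finally show ?thesis using a al by (simp add: zero_less_mult_iff)
qed

text \<open>An integer missed by the binary section \<open>z = 0\<close> can only be attained with
  \<open>z \<noteq> 0\<close>, so this turns each such integer into an upper bound for the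
  discriminant.\<close>

lemma half_disc_le:
  assumes "pos_def (Ternary a b c d e f)" "z \<noteq> 0"
  shows "half_disc (Ternary a b c d e f) \<le> (4 * a * b - f^2) * value_at (Ternary a b c d e f) x y z"
proof -
  have a: "0 < a" using pos_def_xx[OF assms(1)] .
  have al: "0 < 4 * a * b - f^2" using pos_def_minor[OF assms(1)] .
  let ?D = "half_disc (Ternary a b c d e f)"
  have "1 \<le> z^2" using assms(2) by (simp add: int_one_le_iff_zero_less)
  then have "4 * a * ?D * 1 \<le> 4 * a * ?D * z^2"
    using a half_disc_pos[OF assms(1)] by (intro mult_left_mono) auto
  also have "\<dots> \<le> 4 * a * (4 * a * b - f^2) * value_at (Ternary a b c d e f) x y z"
    unfolding value_at_complete_xy using al by simp
  finally show ?thesis using a by simp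
qed

lemma similar_represents:
  assumes "similar s t" "n \<noteq> 0" "n = value_at t x y z" shows "\<exists>x y z. n = value_at s x y z"
proof -
  have "(x, y, z) \<noteq> (0, 0, 0)" using assms(2,3) by (cases t) auto
  then have "n \<in> nonzero_values s"
    using assms by (auto simp: similar_def intro: nonzero_valuesI)
  then show ?thesis by (auto simp: nonzero_values_def)
qed

section \<open>Reduced forms miss a small integer\<close>

lemma square_mem_list:
  fixes s :: int
  assumes "s^2 < 144"
  shows "s^2 \<in> set [0, 1, 4, 9, 16, 25, 36, 49, 64, 81, 100, 121]"
proof -
  have "\<bar>s\<bar>^2 < 12^2" using assms by simp
  then have "\<bar>s\<bar> < 12" by (rule power2_less_imp_less) simp
  then have "\<bar>s\<bar> \<in> set [0..11]" by simp
  moreover have "t^2 \<in> set [0, 1, 4, 9, 16, 25, 36, 49, 64, 81, 100, 121]"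
    if "t \<in> set [0..11]" for t :: int
    using that by (auto simp: upto_rec1)
  ultimately show ?thesis by (metis power2_abs)
qed

text \<open>Sufficient for \<open>n\<close> not to be a value of the reduced form with leading coefficient 1: completing
  the square leaves \<open>4 n\<close> minus a value of the binary form in \<open>y, z\<close>, which would have to be a
  square.  For \<open>n \<le> 31\<close> this square is below \<open>12\<^sup>2\<close>, and \<open>y, z\<close> are at most 7 in absolute value.\<close>

definition avoids :: "int \<Rightarrow> int \<Rightarrow> int \<Rightarrow> int \<Rightarrow> int \<Rightarrow> int \<Rightarrow> bool" where
  "avoids b c d e f n \<longleftrightarrow> list_all (\<lambda>z. list_all (\<lambda>y.
     4 * n - ((4 * b - f * f) * y * y + 2 * (2 * d - e * f) * y * z + (4 * c - e * e) * z * z)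
       \<notin> set [0, 1, 4, 9, 16, 25, 36, 49, 64, 81, 100, 121]) [-7..7]) [0..7]"

lemma avoids_correct:
  assumes "pos_def (Ternary 1 b c d e f)" "reduced (Ternary 1 b c d e f)"
    and "avoids b c d e f n" "n \<le> 31"
  shows "value_at (Ternary 1 b c d e f) x y z \<noteq> n"
proof -
  \<comment> \<open>A vector and its negative have the same value, so \<open>z \<ge> 0\<close> is
    enough and the search box is halved.\<close>
  have *: "value_at (Ternary 1 b c d e f) x y z \<noteq> n" if z: "0 \<le> z" for x y z
  proof
    assume n: "value_at (Ternary 1 b c d e f) x y z = n"
    have "3 \<le> 4 * b - f^2" using reduced_minor_bounds(1)[OF assms(1,2)] by simp
    moreover have "0 \<le> y^2 - \<bar>y * z\<bar> + z^2" using hexagonal_norm_ge(1)[of y z]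
      by (smt (verit) zero_le_power2)
    ultimately have "3 * (y^2 - \<bar>y * z\<bar> + z^2) \<le> (4 * b - f^2) * (y^2 - \<bar>y * z\<bar> + z^2)"
      by (intro mult_right_mono)
    then have "3 * (y^2 - \<bar>y * z\<bar> + z^2) \<le> 4 * 31"
      using reduced_value_ge[OF assms(1,2), of y z x] n assms(4) by simp
    then have "\<bar>y\<bar>^2 < 8^2" "\<bar>z\<bar>^2 < 8^2"
      using hexagonal_norm_ge(1)[of y z] hexagonal_norm_ge(2)[of z y] by simp_all
    then have yz: "\<bar>y\<bar> < 8" "\<bar>z\<bar> < 8" by (auto intro: power2_less_imp_less)
    define G where "G = (4 * b - f * f) * y * y + 2 * (2 * d - e * f) * y * z + (4 * c - e * e) * z * z"
    have s: "4 * n - G = (2 * x + f * y + e * z)^2"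
      using value_at_complete_x[of 1 b c d e f x y z] n by (simp add: G_def power2_eq_square algebra_simps)
    have "0 \<le> G"
      using reduced_binary_ge[OF assms(1,2), of y z] \<open>3 \<le> 4 * b - f^2\<close> \<open>0 \<le> y^2 - \<bar>y * z\<bar> + z^2\<close>
      by (simp add: G_def power2_eq_square mult.assoc) (smt (verit) mult_nonneg_nonneg)
    have "4 * n - G \<in> set [0, 1, 4, 9, 16, 25, 36, 49, 64, 81, 100, 121]"
      unfolding s by (rule square_mem_list) (use s \<open>0 \<le> G\<close> assms(4) in linarith)
    moreover have "z \<in> set [0..7]" "y \<in> set [- 7..7]" using yz z by auto
    ultimately show False
      using assms(3) unfolding avoids_def list_all_iff G_def by blast
  qed
  show ?thesis
  proof (cases "0 \<le> z")
    case False
    then have "value_at (Ternary 1 b c d e f) (- x) (- y) (- z) \<noteq> n" by (intro *) simp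
    then show ?thesis by simp
  qed (rule *)
qed

text \<open>Here \<open>x\<^sup>2 + f x y + b y\<^sup>2\<close> runs through the possible binary sections, and \<open>t\<close> is the least
  positive integer that it does not represent.\<close>

lemma avoid_table:
  "list_all (\<lambda>(b, f, t). list_all (\<lambda>e. list_all (\<lambda>d. list_all (\<lambda>c.
      if \<bar>2 * (2 * d - e * f)\<bar> \<le> 4 * b - f * f \<and> 4 * b - f * f \<le> 4 * c - e * e then
      if (4 * b - f * f) * (4 * c - e * e) - (2 * d - e * f) * (2 * d - e * f) \<le> 4 * (4 * b - f * f) * t
      then list_ex (avoids b c d e f) [3, 5, 6, 7, 10, 13, 14, 17, 21, 22, 23, 29, 31] else True else True)
    [1..5]) [-2..2]) [0..1]) [(1, 1, 2), (1, 0, 3), (2, 1, 3), (2, 0, 5)]"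
  by code_simp

text \<open>This is the escalation argument known from the 15-theorem: representing 1 forces
  \<open>a = 1\<close>, representing 2 leaves four binary sections, and representing the first
  integer missed by the section (2, 3 or 5) leaves finitely many ternary forms.\<close>

theorem exists_unrepresented:
  assumes "pos_def t"
  shows "\<exists>n \<in> {1, 2, 3, 5, 6, 7, 10, 13, 14, 17, 21, 22, 23, 29, 31}. \<forall>x y z. value_at t x y z \<noteq> n"
proof (rule ccontr)
  assume contra: "\<not> ?thesis"
  obtain s where st: "similar s t" and red: "reduced s" using exists_reduced[OF assms] .
  obtain a b c d e f where s: "s = Ternary a b c d e f" by (cases s)
  have pd: "pos_def (Ternary a b c d e f)" using pos_def_similar[OF assms st] s by simp
  have red: "reduced (Ternary a b c d e f)" using red s by simp
  have rep: "\<exists>x y z. value_at (Ternary a b c d e f) x y z = n"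
    if n: "n \<in> {1, 2, 3, 5, 6, 7, 10, 13, 14, 17, 21, 22, 23, 29, 31}" for n
  proof -
    from contra n obtain x y z where "n = value_at t x y z" by metis
    moreover have "n \<noteq> 0" using n by auto
    ultimately show ?thesis using similar_represents[OF st] s by metis
  qed
  have a0: "0 < a" using pos_def_xx[OF pd] .
  obtain x y z where v1: "value_at (Ternary a b c d e f) x y z = 1" using rep[of 1] by auto
  have "a = 1"
  proof (cases "(y, z) = (0, 0)")
    case True
    with v1 have "a * x^2 = 1" by simp
    with a0 show ?thesis by (simp add: zmult_eq_1_iff)
  next
    case False
    \<comment> \<open>Off the x-axis, the value 1 yields
      \<open>3 a^2 \<le> 4 a b - f^2 \<le> 4 a\<close>.\<close>
    from reduced_minor_le_value[OF pd red this, of x] reduced_minor_bounds(1)[OF pd red] v1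
    have "3 * a^2 \<le> 4 * a" by simp
    with a0 show ?thesis by (simp add: power2_eq_square)
  qed
  note pd = pd[unfolded this] and red = red[unfolded this] and rep = rep[unfolded this]
  obtain x y z where v2: "value_at (Ternary 1 b c d e f) x y z = 2" using rep[of 2] by auto
  have "(y, z) \<noteq> (0, 0)"
  proof
    assume "(y, z) = (0, 0)"
    with v2 have x: "\<bar>x\<bar>^2 = 2" by simp
    then have "\<bar>x\<bar>^2 < 2^2" by simp
    then have "\<bar>x\<bar> < 2" by (rule power2_less_imp_less) simp
    then have "x = -1 \<or> x = 0 \<or> x = 1" by auto
    with x show False by auto
  qed
  from reduced_minor_le_value[OF pd red this, of x] v2 have al8: "4 * b - f^2 \<le> 8" by simp
  have r: "0 \<le> f" "f \<le> 1" "0 \<le> e" "e \<le> 1" "1 \<le> b" "\<bar>2 * (2 * d - e * f)\<bar> \<le> 4 * b - f * f"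
    "4 * b - f * f \<le> 4 * c - e * e"
    using red by (auto simp: reduced_def power2_eq_square)
  then have fe: "f \<in> {0, 1}" "e \<in> {0, 1}" by auto
  then have b: "b \<in> {1, 2}" using al8 r(5) by auto
  have d: "- 2 \<le> d" "d \<le> 2" using r fe b by (auto simp: abs_le_iff)
  have bound: "half_disc (Ternary 1 b c d e f) \<le> (4 * b - f^2) * n"
    if n: "n \<in> {1, 2, 3, 5, 6, 7, 10, 13, 14, 17, 21, 22, 23, 29, 31}"
      and no: "\<And>x y. value_at (Ternary 1 b c d e f) x y 0 \<noteq> n" for n
  proof -
    obtain x y z where v: "value_at (Ternary 1 b c d e f) x y z = n" using rep[OF n] by auto
    with no have "z \<noteq> 0" by metis
    from half_disc_le[OF pd this, of x y] v show ?thesis by simp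
  qed
  have binary: "(2 * x + f * y)^2 + (4 * b - f^2) * y^2 = 4 * value_at (Ternary 1 b c d e f) x y 0" for x y
    by (simp add: algebra_simps power2_eq_square)
  define T where "T = (if b = 1 then if f = 1 then 2 else 3 else if f = 1 then 3 else 5 :: int)"
  have "half_disc (Ternary 1 b c d e f) \<le> (4 * b - f^2) * T"
  proof (rule bound)
    show "T \<in> {1, 2, 3, 5, 6, 7, 10, 13, 14, 17, 21, 22, 23, 29, 31}" by (simp add: T_def)
    fix x y
    show "value_at (Ternary 1 b c d e f) x y 0 \<noteq> T"
    proof
      assume "value_at (Ternary 1 b c d e f) x y 0 = T"
      then have *: "(2 * x + f * y)^2 + (4 * b - f^2) * y^2 = 4 * T" using binary by simp
      define s where "s = 2 * x + f * y"
      have **: "s^2 + (4 * b - f^2) * y^2 = 4 * T" using * by (simp add: s_def)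
      have "0 \<le> s^2" by simp
      with ** have "(4 * b - f^2) * y^2 \<le> 4 * T" by linarith
      then have "y^2 < 2^2" using fe b by (auto simp: T_def)
      then have "\<bar>y\<bar>^2 < 2^2" by simp
      then have "\<bar>y\<bar> < 2" by (rule power2_less_imp_less) simp
      then have y: "y \<in> {-1, 0, 1}" by auto
      have "s^2 \<in> set [0, 1, 4, 9, 16, 25, 36, 49, 64, 81, 100, 121]"
        by (rule square_mem_list) (use ** y fe b in \<open>auto simp: T_def\<close>)
      with ** y fe b show False by (auto simp: T_def)
    qed
  qed
  then have D: "(4 * b - f * f) * (4 * c - e * e) - (2 * d - e * f) * (2 * d - e * f) \<le> 4 * (4 * b - f * f) * T"
    by (simp add: algebra_simps power2_eq_square)
  have "d \<in> {-2, -1, 0, 1, 2}" using d by auto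
  \<comment> \<open>With \<alpha>, \<beta>, \<gamma> for the minors,
    \<open>\<alpha> \<gamma> - \<beta>^2 \<le> 4 \<alpha> T\<close> and
    \<open>2 \<bar>\<beta>\<bar> \<le> \<alpha>\<close> give
    \<open>\<gamma> \<le> 4 T + \<alpha> / 4\<close>, which is 22 in the largest case.\<close>
  with D fe b r have c: "1 \<le> c" "c \<le> 5" by (auto simp: T_def)
  have "(b, f, T) \<in> set [(1, 1, 2), (1, 0, 3), (2, 1, 3), (2, 0, 5)]"
    using fe b by (auto simp: T_def)
  note table = bspec[OF avoid_table[unfolded list_all_iff] this, unfolded prod.case]
  have "e \<in> set [0..1]" "d \<in> set [- 2..2]" "c \<in> set [1..5]" using fe d c by auto
  from table[rule_format, OF this]
  have "list_ex (avoids b c d e f) [3, 5, 6, 7, 10, 13, 14, 17, 21, 22, 23, 29, 31]"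
    by (simp only: r(6,7) D if_True simp_thms)
  then obtain n where n: "n \<in> {3, 5, 6, 7, 10, 13, 14, 17, 21, 22, 23, 29, 31}" "avoids b c d e f n"
    unfolding list_ex_iff by auto
  moreover from n(1) have "n \<le> 31" by auto
  ultimately have "\<forall>x y z. value_at (Ternary 1 b c d e f) x y z \<noteq> n"
    using avoids_correct[OF pd red n(2)] by blast
  with rep[of n] n(1) show False by auto
qed

section \<open>Sums over hyperbola regions\<close>

lemma abel_summation_bound:
  fixes g w :: "nat \<Rightarrow> real"
  assumes bound: "\<And>k. \<bar>\<Sum>i\<in>{m<..k}. g i\<bar> \<le> A"
    and decr: "\<And>i. m < i \<Longrightarrow> w (Suc i) \<le> w i" and nonneg: "\<And>i. m < i \<Longrightarrow> 0 \<le> w i"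
  shows "\<bar>\<Sum>i\<in>{m<..n}. g i * w i\<bar> \<le> A * w (Suc m)"
proof (cases "m < n")
  case False
  then have "{m<..n} = {}" by simp
  moreover have "0 \<le> A" using bound[of m] by simp
  ultimately show ?thesis using nonneg[of "Suc m"] by simp
next
  case True
  define S where "S = (\<lambda>k. \<Sum>i\<in>{m<..k}. g i)"
  \<comment> \<open>Summation by parts: with the boundary term moved to the left, the differences of
    \<open>w\<close> telescope.\<close>
  have *: "\<bar>(\<Sum>i\<in>{m<..m + Suc j}. g i * w i) - S (m + Suc j) * w (m + Suc j)\<bar>
      \<le> A * (w (Suc m) - w (m + Suc j))" for j
  proof (induction j)
    case 0
    have "{m<..m + Suc 0} = {Suc m}" by auto
    then show ?case by (simp add: S_def)
  next
    case (Suc j)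
    let ?k = "m + Suc j"
    have split: "{m<..Suc ?k} = insert (Suc ?k) {m<..?k}" by auto
    have "(\<Sum>i\<in>{m<..Suc ?k}. g i * w i) - S (Suc ?k) * w (Suc ?k)
       = ((\<Sum>i\<in>{m<..?k}. g i * w i) - S ?k * w ?k) + S ?k * (w ?k - w (Suc ?k))"
      unfolding S_def split by (simp add: algebra_simps)
    moreover have "\<bar>S ?k * (w ?k - w (Suc ?k))\<bar> \<le> A * (w ?k - w (Suc ?k))"
      using bound[of ?k] decr[of ?k] unfolding S_def abs_mult by (intro mult_mono) auto
    ultimately have "\<bar>(\<Sum>i\<in>{m<..Suc ?k}. g i * w i) - S (Suc ?k) * w (Suc ?k)\<bar>
       \<le> A * (w (Suc m) - w ?k) + A * (w ?k - w (Suc ?k))"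
      using Suc by linarith
    then show ?case by (simp add: algebra_simps)
  qed
  from True obtain j where n: "n = m + Suc j" using less_imp_Suc_add by auto
  have "\<bar>S n * w n\<bar> \<le> A * w n"
    using bound[of n] nonneg[OF True] unfolding S_def abs_mult by (intro mult_mono) auto
  with *[of j] show ?thesis unfolding n by (simp add: algebra_simps)
qed

lemma periodic_sum_block:
  fixes g :: "nat \<Rightarrow> real"
  assumes "\<And>i. g (i + N) = g i" "(\<Sum>i<N. g i) = 0"
  shows "(\<Sum>i\<in>{m<..m + N}. g i) = 0"
proof -
  have "(\<Sum>i\<in>{m..<m + N}. g i) = 0" for m
  proof (induction m)
    case 0
    then show ?case using assms(2) by (simp add: lessThan_atLeast0)
  next
    case (Suc m)
    have "(\<Sum>i\<in>{m..<Suc (m + N)}. g i) = (\<Sum>i\<in>{m..<m + N}. g i) + g (m + N)" by simp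
    moreover have "(\<Sum>i\<in>{m..<Suc (m + N)}. g i) = g m + (\<Sum>i\<in>{Suc m..<Suc (m + N)}. g i)"
      by (simp add: sum.atLeast_Suc_lessThan)
    ultimately show ?case using Suc assms(1)[of m] by simp
  qed
  moreover have "{m<..m + N} = {Suc m..<Suc m + N}" by auto
  ultimately show ?thesis by metis
qed

lemma periodic_partial_sum_bound:
  fixes g :: "nat \<Rightarrow> real"
  assumes "0 < N" "\<And>i. g (i + N) = g i" "(\<Sum>i<N. g i) = 0" "\<And>i. \<bar>g i\<bar> \<le> C"
  shows "\<bar>\<Sum>i\<in>{m<..k}. g i\<bar> \<le> N * C"
proof (induction "k - m" arbitrary: m rule: less_induct)
  case less
  show ?case
  proof (cases "k \<le> m + N")
    case True
    have "\<bar>\<Sum>i\<in>{m<..k}. g i\<bar> \<le> (\<Sum>i\<in>{m<..k}. C)"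
      by (rule order_trans[OF sum_abs]) (intro sum_mono assms(4))
    also have "\<dots> = real (k - m) * C" by simp
    also have "\<dots> \<le> N * C" using True assms(4)[of 0] by (intro mult_right_mono) auto
    finally show ?thesis .
  next
    case False
    have "{m<..k} = {m<..m + N} \<union> {m + N<..k}" using False by auto
    then have "(\<Sum>i\<in>{m<..k}. g i) = (\<Sum>i\<in>{m<..m + N}. g i) + (\<Sum>i\<in>{m + N<..k}. g i)"
      by (simp add: sum.union_disjoint)
    with periodic_sum_block[of g N m] assms(2,3) less[of "m + N"] False assms(1) show ?thesis
      by simp
  qed
qed

lemma periodic_weighted_sum_bound:
  fixes g :: "nat \<Rightarrow> real"
  assumes "0 < N" "\<And>i. g (i + N) = g i" "(\<Sum>i<N. g i) = 0" "\<And>i. \<bar>g i\<bar> \<le> C"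
  shows "\<bar>\<Sum>i\<in>{m<..k}. g i / sqrt i\<bar> \<le> N * C / sqrt (Suc m)"
proof -
  have "\<bar>\<Sum>i\<in>{m<..k}. g i * (1 / sqrt i)\<bar> \<le> N * C * (1 / sqrt (Suc m))"
    by (rule abel_summation_bound) (auto intro!: periodic_partial_sum_bound assms divide_left_mono)
  then show ?thesis by simp
qed

lemma sum_inverse_sqrt_le: "(\<Sum>i\<in>{0<..n::nat}. 1 / sqrt i) \<le> 2 * sqrt n"
proof (induction n)
  case (Suc n)
  have "{0<..Suc n} = insert (Suc n) {0<..n}" by auto
  then have "(\<Sum>i\<in>{0<..Suc n}. 1 / sqrt i) \<le> 2 * sqrt n + 1 / sqrt (Suc n)" using Suc by simp
  also have "\<dots> \<le> 2 * sqrt (Suc n)"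
  proof -
    define s t where "s = sqrt n" and "t = sqrt (Suc n)"
    have st: "t^2 = s^2 + 1" "0 \<le> s" "0 < t" by (simp_all add: s_def t_def)
    \<comment> \<open>This is \<open>(t - s)^2 \<ge> 0\<close> with \<open>s^2\<close> replaced by
      \<open>t^2 - 1\<close>.\<close>
    have "2 * s * t + 1 \<le> 2 * t * t" using st sum_squares_ge_zero[of "t - s" 0]
      by (simp add: power2_eq_square algebra_simps)
    with st show ?thesis unfolding s_def[symmetric] t_def[symmetric]
      by (simp add: field_simps)
  qed
  finally show ?case .
qed simp

definition hyperbola_region :: "nat \<Rightarrow> (nat \<times> nat) set" where
  "hyperbola_region x = {(a, b). 0 < a \<and> 0 < b \<and> a * b \<le> x}"

text \<open>Dirichlet's hyperbola method: \<open>a\<close> and \<open>b\<close> cannot both exceed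
  \<open>M\<close>, so the region is a square and two arms. A square bound keeps the cutting point
  an integer.\<close>

lemma sum_hyperbola_region_square:
  fixes F :: "nat \<Rightarrow> nat \<Rightarrow> real"
  shows "(\<Sum>(a, b)\<in>hyperbola_region (M^2). F a b) =
    (\<Sum>a\<in>{0<..M}. \<Sum>b\<in>{0<..M}. F a b)
    + (\<Sum>a\<in>{0<..M}. \<Sum>b\<in>{M<..M^2 div a}. F a b)
    + (\<Sum>b\<in>{0<..M}. \<Sum>a\<in>{M<..M^2 div b}. F a b)"
proof -
  define R where "R = {0<..M} \<times> {0<..M}"
  define S where "S = (SIGMA a:{0<..M}. {M<..M^2 div a})"
  define T where "T = (\<lambda>(b, a). (a, b)) ` S"
  have mem: "b \<le> M^2 div a \<longleftrightarrow> a * b \<le> M^2" if "0 < a" for a b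
    using that by (simp add: less_eq_div_iff_mult_less_eq mult.commute)
  have "hyperbola_region (M^2) = (R \<union> S) \<union> T"
  proof (intro equalityI subsetI)
    fix p assume "p \<in> hyperbola_region (M^2)"
    then obtain a b where p: "p = (a, b)" "0 < a" "0 < b" "a * b \<le> M^2"
      by (auto simp: hyperbola_region_def)
    have "\<not> (M < a \<and> M < b)"
    proof
      assume "M < a \<and> M < b"
      then have "M * M < a * b" by (intro mult_strict_mono) auto
      with p show False by (simp add: power2_eq_square)
    qed
    then show "p \<in> (R \<union> S) \<union> T" using p mem[of a b] mem[of b a]
      by (auto simp: R_def S_def T_def mult.commute)
  next
    fix p assume "p \<in> (R \<union> S) \<union> T"
    moreover have "a * b \<le> M * M" if "a \<le> M" "b \<le> M" for a b using that by (rule mult_le_mono)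
    ultimately show "p \<in> hyperbola_region (M^2)"
      using mem by (auto simp: R_def S_def T_def hyperbola_region_def power2_eq_square mult.commute)
  qed
  moreover have "R \<inter> S = {}" "(R \<union> S) \<inter> T = {}" by (auto simp: R_def S_def T_def)
  moreover have "finite R" "finite S" "finite T" by (auto simp: R_def S_def T_def)
  ultimately have "(\<Sum>(a, b)\<in>hyperbola_region (M^2). F a b) =
      (\<Sum>(a, b)\<in>R. F a b) + (\<Sum>(a, b)\<in>S. F a b) + (\<Sum>(a, b)\<in>T. F a b)"
    by (simp add: sum.union_disjoint)
  moreover have "(\<Sum>(a, b)\<in>T. F a b) = (\<Sum>(b, a)\<in>S. F a b)"
    unfolding T_def by (subst sum.reindex) (auto simp: inj_on_def case_prod_unfold o_def)
  ultimately show ?thesis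
    unfolding R_def S_def by (simp add: sum.Sigma sum.cartesian_product)
qed

text \<open>In an arm the inner sum starts beyond \<open>M\<close> and is of order
  \<open>1 / sqrt M\<close>, while the outer weights add up to order \<open>sqrt M\<close>; the
  weight \<open>1 / sqrt\<close> is the one that balances the two. On the square, the inner sum is
  bounded, and as a function of \<open>a\<close> it is again periodic with mean 0. The square
  accounts for \<open>N * (N * C)\<close> and each arm for \<open>2 * (N * C)\<close>.\<close>

lemma hyperbola_sum_bound:
  fixes K :: "nat \<Rightarrow> nat \<Rightarrow> real"
  assumes "0 < N"
    and per: "\<And>a b. K (a + N) b = K a b" "\<And>a b. K a (b + N) = K a b"
    and zero: "\<And>b. (\<Sum>a<N. K a b) = 0" "\<And>a. (\<Sum>b<N. K a b) = 0"
    and bound: "\<And>a b. \<bar>K a b\<bar> \<le> C"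
  shows "\<bar>\<Sum>(a, b)\<in>hyperbola_region (M^2). K a b / (sqrt a * sqrt b)\<bar> \<le> N * (N * C) + 4 * (N * C)"
proof -
  have C: "0 \<le> C" using bound[of 0 0] by simp
  have tail: "\<bar>\<Sum>a\<in>{0<..M}. \<Sum>b\<in>{M<..M^2 div a}. L a b / (sqrt a * sqrt b)\<bar> \<le> 2 * (N * C)"
    if L: "\<And>a b. L a (b + N) = L a b" "\<And>a. (\<Sum>b<N. L a b) = 0" "\<And>a b. \<bar>L a b\<bar> \<le> C"
    for L :: "nat \<Rightarrow> nat \<Rightarrow> real"
  proof -
    have "\<bar>\<Sum>a\<in>{0<..M}. \<Sum>b\<in>{M<..M^2 div a}. L a b / (sqrt a * sqrt b)\<bar>
        \<le> (\<Sum>a\<in>{0<..M}. 1 / sqrt a * (N * C / sqrt (Suc M)))"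
    proof (rule order_trans[OF sum_abs], intro sum_mono)
      fix a
      have "(\<Sum>b\<in>{M<..M^2 div a}. L a b / (sqrt a * sqrt b)) = 1 / sqrt a * (\<Sum>b\<in>{M<..M^2 div a}. L a b / sqrt b)"
        by (simp add: sum_distrib_left)
      also have "\<bar>\<dots>\<bar> = 1 / sqrt a * \<bar>\<Sum>b\<in>{M<..M^2 div a}. L a b / sqrt b\<bar>"
        by (simp add: abs_mult)
      also have "\<dots> \<le> 1 / sqrt a * (N * C / sqrt (Suc M))"
        by (intro mult_left_mono periodic_weighted_sum_bound assms L) auto
      finally show "\<bar>\<Sum>b\<in>{M<..M^2 div a}. L a b / (sqrt a * sqrt b)\<bar> \<le> 1 / sqrt a * (N * C / sqrt (Suc M))" .
    qed
    also have "\<dots> = (\<Sum>a\<in>{0<..M}. 1 / sqrt a) * (N * C / sqrt (Suc M))"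
      by (simp only: sum_distrib_right)
    also have "\<dots> \<le> (2 * sqrt (Suc M)) * (N * C / sqrt (Suc M))"
      using sum_inverse_sqrt_le[of M] C by (intro mult_right_mono) (auto intro: order_trans)
    also have "\<dots> = 2 * (N * C)" by simp
    finally show ?thesis .
  qed
  define F where "F = (\<lambda>a. \<Sum>b\<in>{0<..M}. K a b / sqrt b)"
  have "\<bar>\<Sum>a\<in>{0<..M}. F a / sqrt a\<bar> \<le> N * (N * C) / sqrt (Suc 0)"
  proof (rule periodic_weighted_sum_bound)
    show "F (a + N) = F a" for a by (simp add: F_def per)
    have "(\<Sum>a<N. F a) = (\<Sum>b\<in>{0<..M}. (\<Sum>a<N. K a b) / sqrt b)"
      unfolding F_def by (subst sum.swap) (simp add: sum_divide_distrib)
    then show "(\<Sum>a<N. F a) = 0" by (simp add: zero)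
    show "\<bar>F a\<bar> \<le> N * C" for a
      using periodic_weighted_sum_bound[of N "K a" C 0 M] assms by (simp add: F_def)
  qed (fact assms)
  moreover have "(\<Sum>a\<in>{0<..M}. \<Sum>b\<in>{0<..M}. K a b / (sqrt a * sqrt b)) = (\<Sum>a\<in>{0<..M}. F a / sqrt a)"
    by (simp add: F_def sum_divide_distrib mult.commute)
  moreover have "\<bar>\<Sum>a\<in>{0<..M}. \<Sum>b\<in>{M<..M^2 div a}. K a b / (sqrt a * sqrt b)\<bar> \<le> 2 * (N * C)"
    using assms by (intro tail) auto
  moreover have "\<bar>\<Sum>b\<in>{0<..M}. \<Sum>a\<in>{M<..M^2 div b}. K a b / (sqrt a * sqrt b)\<bar> \<le> 2 * (N * C)"
    using tail[of "\<lambda>b a. K a b"] assms by (simp add: mult.commute)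
  ultimately show ?thesis unfolding sum_hyperbola_region_square by simp
qed

lemma sum_hyperbola_region_divisors:
  fixes F :: "nat \<Rightarrow> nat \<Rightarrow> real"
  shows "(\<Sum>(a, b)\<in>hyperbola_region x. F (a * b) b) = (\<Sum>m\<in>{0<..x}. \<Sum>b | b dvd m. F m b)"
proof -
  have "(\<Sum>m\<in>{0<..x}. \<Sum>b | b dvd m. F m b) = (\<Sum>(m, b)\<in>(SIGMA m:{0<..x}. {b. b dvd m}). F m b)"
    by (rule sum.Sigma) auto
  also have "\<dots> = (\<Sum>(a, b)\<in>hyperbola_region x. F (a * b) b)"
    by (rule sum.reindex_bij_witness[where i = "\<lambda>(a, b). (a * b, b)" and j = "\<lambda>(m, b). (m div b, b)"])
      (auto simp: hyperbola_region_def dvd_pos_nat)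
  finally show ?thesis by simp
qed

section \<open>Quadratic characters in residue classes\<close>

text \<open>A real Dirichlet character modulo \<open>N\<close>. That it is not principal is
  expressed where required by some \<open>u\<close> with \<open>\<psi> u = -1\<close>.\<close>

locale quadratic_character =
  fixes N :: nat and \<psi> :: "nat \<Rightarrow> int"
  assumes modulus_pos: "0 < N"
    and mult: "\<psi> (a * b) = \<psi> a * \<psi> b"
    and periodic: "\<psi> (a + N) = \<psi> a"
    and coprime_values: "coprime a N \<Longrightarrow> \<psi> a = 1 \<or> \<psi> a = -1"
    and noncoprime_values: "\<not> coprime a N \<Longrightarrow> \<psi> a = 0"
begin

lemma one [simp]: "\<psi> 1 = 1"
proof -
  have "\<psi> 1 * \<psi> 1 = \<psi> 1" using mult[of 1 1] by simp
  moreover have "\<psi> 1 \<noteq> 0" using coprime_values[of 1] by auto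
  ultimately show ?thesis by simp
qed

lemma power: "\<psi> (a ^ k) = \<psi> a ^ k"
  by (induction k) (use one in \<open>auto simp: mult\<close>)

lemma value_cases: "\<psi> a \<in> {-1, 0, 1}"
  using coprime_values noncoprime_values by (cases "coprime a N") auto

lemma nonzero_iff: "\<psi> a \<noteq> 0 \<longleftrightarrow> coprime a N"
  using coprime_values noncoprime_values by (cases "coprime a N") force+

lemma square: "\<psi> a ^ 2 = (if coprime a N then 1 else 0)"
  using coprime_values[of a] noncoprime_values[of a] by auto

lemma reduce_mod: "\<psi> (a mod N) = \<psi> a"
proof -
  have "\<psi> (b + k * N) = \<psi> b" for b k
  proof (induction k)
    case (Suc k)
    have "b + Suc k * N = (b + k * N) + N" by simp
    then show ?case using Suc periodic by metis
  qed simp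
  from this[of "a mod N" "a div N"] show ?thesis by (simp add: add.commute)
qed

lemma cong: "[a = b] (mod N) \<Longrightarrow> \<psi> a = \<psi> b"
  by (metis cong_def reduce_mod)

text \<open>The Dirichlet convolution of 1 and \<open>\<psi>\<close>, that is, the coefficients of
  the product of the zeta function and the L-function of \<open>\<psi>\<close>.\<close>

definition divisor_sum :: "nat \<Rightarrow> int" where
  "divisor_sum m = (\<Sum>d | d dvd m. \<psi> d)"

lemma divisor_sum_prime_power:
  assumes "prime q" "\<not> q dvd m"
  shows "divisor_sum (q ^ j * m) = (\<Sum>i\<le>j. \<psi> q ^ i) * divisor_sum m"
proof (induction j)
  case (Suc j)
  have m: "m \<noteq> 0" and q: "q \<noteq> 0" using assms by (auto intro: Nat.gr0I)
  have inj: "inj_on (\<lambda>d. q ^ Suc j * d) {d. d dvd m}" using q by (auto simp: inj_on_def)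
  \<comment> \<open>The divisors are separated by whether they contain the full power of
    \<open>q\<close>.\<close>
  have "{d. d dvd q ^ Suc j * m} = {d. d dvd q ^ j * m} \<union> (\<lambda>d. q ^ Suc j * d) ` {d. d dvd m}"
  proof (intro equalityI subsetI)
    fix d assume "d \<in> {d. d dvd q ^ Suc j * m}"
    then have d: "d dvd q ^ Suc j * m" by simp
    show "d \<in> {d. d dvd q ^ j * m} \<union> (\<lambda>d. q ^ Suc j * d) ` {d. d dvd m}"
    proof (cases "q ^ Suc j dvd d")
      case True
      then obtain d' where "d = q ^ Suc j * d'" by blast
      then show ?thesis using d q by auto
    next
      case False
      obtain x y where xy: "d = x * y" "x dvd q ^ Suc j" "y dvd m" using d division_decomp by blast
      obtain i where i: "x = q ^ i" "i \<le> Suc j" using xy(2) assms(1) divides_primepow_nat by blast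
      have "i \<noteq> Suc j" using False xy i by auto
      then have "x dvd q ^ j" using i by (simp add: le_imp_power_dvd)
      then show ?thesis using xy by (auto intro: mult_dvd_mono)
    qed
  next
    fix d assume "d \<in> {d. d dvd q ^ j * m} \<union> (\<lambda>d. q ^ Suc j * d) ` {d. d dvd m}"
    then show "d \<in> {d. d dvd q ^ Suc j * m}"
    proof
      assume "d \<in> {d. d dvd q ^ j * m}"
      then have "d dvd q * (q ^ j * m)" by simp
      then show ?thesis by (simp add: mult.assoc)
    next
      assume "d \<in> (\<lambda>d. q ^ Suc j * d) ` {d. d dvd m}"
      then show ?thesis by (auto intro: mult_dvd_mono simp del: power_Suc)
    qed
  qed
  moreover have "{d. d dvd q ^ j * m} \<inter> (\<lambda>d. q ^ Suc j * d) ` {d. d dvd m} = {}"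
  proof -
    have "\<not> q ^ Suc j * d dvd q ^ j * m" for d
    proof
      assume "q ^ Suc j * d dvd q ^ j * m"
      then have "q ^ j * (q * d) dvd q ^ j * m" by (simp add: ac_simps)
      then have "q * d dvd m" using q by simp
      then show False using assms(2) dvd_mult_left by blast
    qed
    then show ?thesis by auto
  qed
  moreover have "finite {d. d dvd q ^ j * m}" "finite {d. d dvd m}" using m q by auto
  ultimately have "divisor_sum (q ^ Suc j * m)
      = divisor_sum (q ^ j * m) + (\<Sum>d | d dvd m. \<psi> (q ^ Suc j * d))"
    unfolding divisor_sum_def using inj by (simp add: sum.union_disjoint sum.reindex)
  also have "(\<Sum>d | d dvd m. \<psi> (q ^ Suc j * d)) = \<psi> q ^ Suc j * divisor_sum m"
    by (simp add: divisor_sum_def mult power sum_distrib_left mult_ac)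
  finally show ?case using Suc by (simp add: algebra_simps)
qed simp

lemma geometric_sum_nonneg: "0 \<le> (\<Sum>i\<le>j. \<psi> q ^ i)"
  and geometric_sum_even: "even j \<Longrightarrow> 1 \<le> (\<Sum>i\<le>j. \<psi> q ^ i)"
  and geometric_sum_odd: "odd j \<Longrightarrow> \<psi> q = -1 \<Longrightarrow> (\<Sum>i\<le>j. \<psi> q ^ i) = 0"
proof -
  have *: "(\<Sum>i\<le>j. \<psi> q ^ i) = (if \<psi> q = 1 then int j + 1 else if \<psi> q = 0 then 1 else if even j then 1 else 0)"
    using value_cases[of q] by (induction j) auto
  show "0 \<le> (\<Sum>i\<le>j. \<psi> q ^ i)" "even j \<Longrightarrow> 1 \<le> (\<Sum>i\<le>j. \<psi> q ^ i)"
    "odd j \<Longrightarrow> \<psi> q = -1 \<Longrightarrow> (\<Sum>i\<le>j. \<psi> q ^ i) = 0"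
    unfolding * by auto
qed

lemma prime_power_split:
  fixes m :: nat
  assumes "1 < m"
  obtains q j m' where "prime q" "m = q ^ j * m'" "\<not> q dvd m'" "0 < m'" "m' < m"
proof -
  obtain q where q: "prime q" "q dvd m" using assms prime_factor_nat[of m] by auto
  obtain m' where m': "m = q ^ multiplicity q m * m'" "\<not> q dvd m'"
    by (rule multiplicity_decompose'[of m q]) (use assms q not_prime_unit in auto)
  have pos: "0 < m'" using m' assms by (intro Nat.gr0I) auto
  have "1 < q ^ multiplicity q m"
    using q assms prime_gt_1_nat[OF q(1)] by (intro one_less_power) (auto simp: prime_multiplicity_gt_zero_iff)
  then have "1 * m' < q ^ multiplicity q m * m'" using pos by (intro mult_strict_right_mono)
  then show thesis using that[OF q(1) m' pos] m'(1) by simp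
qed

lemma divisor_sum_1 [simp]: "divisor_sum (Suc 0) = 1"
  using one by (simp add: divisor_sum_def)

lemma divisor_sum_nonneg: "0 < m \<Longrightarrow> 0 \<le> divisor_sum m"
proof (induction m rule: less_induct)
  case (less m)
  show ?case
  proof (cases "m = 1")
    case False
    with less.prems obtain q j m' where q: "prime q" "m = q ^ j * m'" "\<not> q dvd m'" "0 < m'" "m' < m"
      using prime_power_split[of m] by (metis One_nat_def Suc_lessI)
    have "divisor_sum m = (\<Sum>i\<le>j. \<psi> q ^ i) * divisor_sum m'"
      unfolding q(2) by (rule divisor_sum_prime_power) (fact q)+
    then show ?thesis using less.IH[OF q(5,4)] geometric_sum_nonneg[of q j] by simp
  qed simp
qed

text \<open>All multiplicities in a square are even, so every local factor is at least 1, even at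
  primes where \<open>\<psi>\<close> is -1.\<close>

lemma divisor_sum_square: "0 < m \<Longrightarrow> 1 \<le> divisor_sum (m ^ 2)"
proof (induction m rule: less_induct)
  case (less m)
  show ?case
  proof (cases "m = 1")
    case False
    with less.prems obtain q j m' where q: "prime q" "m = q ^ j * m'" "\<not> q dvd m'" "0 < m'" "m' < m"
      using prime_power_split[of m] by (metis One_nat_def Suc_lessI)
    have "divisor_sum (q ^ (2 * j) * m' ^ 2) = (\<Sum>i\<le>2 * j. \<psi> q ^ i) * divisor_sum (m' ^ 2)"
      by (rule divisor_sum_prime_power) (use q prime_dvd_power in blast)+
    moreover have "q ^ (2 * j) * m' ^ 2 = m ^ 2"
      unfolding q(2) by (simp add: power_mult_distrib power_mult mult.commute flip: power_mult)
    moreover have "1 * 1 \<le> (\<Sum>i\<le>2 * j. \<psi> q ^ i) * divisor_sum (m' ^ 2)"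
      using less.IH[OF q(5,4)] geometric_sum_even[of "2 * j" q] by (intro mult_mono) auto
    ultimately show ?thesis by simp
  qed simp
qed

text \<open>The alternating local factor 1 - 1 + ... - 1 of an odd multiplicity vanishes. This is
  how positivity of the sum yields arithmetic information on the squarefree part.\<close>

lemma divisor_sum_even_multiplicity:
  assumes "0 < divisor_sum m" "0 < m" "prime q" "\<psi> q = -1"
  shows "even (multiplicity q m)"
proof (rule ccontr)
  assume odd: "odd (multiplicity q m)"
  obtain m' where m': "m = q ^ multiplicity q m * m'" "\<not> q dvd m'"
    by (rule multiplicity_decompose'[of m q]) (use assms not_prime_unit in auto)
  have "divisor_sum m = (\<Sum>i\<le>multiplicity q m. \<psi> q ^ i) * divisor_sum m'"
    by (subst m'(1), rule divisor_sum_prime_power) (fact assms m')+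
  with geometric_sum_odd[OF odd assms(4)] assms(1) show False by simp
qed

end

section \<open>Mean values and the comparison of residue classes\<close>

context quadratic_character begin

lemma sum_eq_zero:
  assumes "\<psi> u = -1" shows "(\<Sum>i<N. \<psi> i) = 0"
proof -
  have u: "coprime u N" using nonzero_iff[of u] assms by simp
  have inj: "inj_on (\<lambda>i. u * i mod N) {..<N}"
  proof (rule inj_onI)
    fix i j assume ij: "i \<in> {..<N}" "j \<in> {..<N}" "u * i mod N = u * j mod N"
    then have "[i = j] (mod N)" using cong_mult_lcancel_nat[OF u] by (simp add: cong_def)
    then show "i = j" using ij cong_less_modulus_unique_nat by blast
  qed
  moreover have "(\<lambda>i. u * i mod N) ` {..<N} \<subseteq> {..<N}" using modulus_pos by auto
  ultimately have "(\<lambda>i. u * i mod N) ` {..<N} = {..<N}" by (intro endo_inj_surj) auto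
  then have "(\<Sum>i<N. \<psi> i) = (\<Sum>i<N. \<psi> (u * i mod N))"
    using sum.reindex[OF inj, of \<psi>] by (simp add: o_def)
  also have "\<dots> = - (\<Sum>i<N. \<psi> i)" by (simp add: reduce_mod mult assms sum_negf)
  finally show ?thesis by simp
qed

text \<open>A unit \<open>a\<close> has exactly one cofactor \<open>b\<close>, and
  \<open>\<psi> a * \<psi> b = \<psi> \<tau> = 1\<close> makes the two signs equal. If
  \<open>a\<close> is not a unit, there is no cofactor and both sides are 0.\<close>

lemma sum_residue_class:
  assumes \<tau>: "coprime \<tau> N" "\<psi> \<tau> = 1"
  shows "(\<Sum>b<N. if [a * b = \<tau>] (mod N) then \<psi> b else 0) = \<psi> a"
    and "(\<Sum>b<N. if [a * b = \<tau>] (mod N) then 1 else 0) = \<psi> a ^ 2"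
proof -
  have "(\<Sum>b<N. if [a * b = \<tau>] (mod N) then \<psi> b else 0) = \<psi> a \<and>
    (\<Sum>b<N. if [a * b = \<tau>] (mod N) then 1 else 0) = \<psi> a ^ 2"
  proof (cases "coprime a N")
    case False
    have "\<not> [a * b = \<tau>] (mod N)" for b
    proof
      assume "[a * b = \<tau>] (mod N)"
      then have "coprime (a * b) N" using \<tau>(1) coprime_cong_cong_left by blast
      then show False using False by simp
    qed
    then show ?thesis using noncoprime_values[OF False] by simp
  next
    case True
    then obtain x where x: "[a * x = 1] (mod N)" using cong_solve_coprime_nat[OF True] by auto
    define b0 where "b0 = x * \<tau> mod N"
    have b0: "b0 < N" using modulus_pos by (simp add: b0_def)
    have "[a * b0 = (a * x) * \<tau>] (mod N)"
      by (simp add: b0_def cong_def mod_mult_right_eq mult.assoc)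
    also have "[(a * x) * \<tau> = 1 * \<tau>] (mod N)" using x by (rule cong_scalar_right)
    finally have ab0: "[a * b0 = \<tau>] (mod N)" by simp
    have iff: "[a * b = \<tau>] (mod N) \<longleftrightarrow> b = b0" if "b < N" for b
    proof
      assume "[a * b = \<tau>] (mod N)"
      then have "[a * b = a * b0] (mod N)" using ab0 cong_sym cong_trans by blast
      then have "[b = b0] (mod N)" using cong_mult_lcancel_nat[OF True] by simp
      then show "b = b0" using that b0 cong_less_modulus_unique_nat by blast
    qed (use ab0 in simp)
    have "\<psi> a * \<psi> b0 = 1" using cong[OF ab0] \<tau>(2) mult by simp
    then have "\<psi> b0 = \<psi> a" using value_cases[of a] value_cases[of b0] by auto
    moreover have "(\<Sum>b<N. if [a * b = \<tau>] (mod N) then \<psi> b else 0) = (\<Sum>b<N. if b = b0 then \<psi> b else 0)"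
      by (intro sum.cong) (auto simp: iff)
    moreover have "(\<Sum>b<N. if [a * b = \<tau>] (mod N) then 1 else 0) = (\<Sum>b<N. if b = b0 then 1 else 0 :: int)"
      by (intro sum.cong) (auto simp: iff)
    ultimately show ?thesis using b0 True by (simp add: square)
  qed
  then show "(\<Sum>b<N. if [a * b = \<tau>] (mod N) then \<psi> b else 0) = \<psi> a"
    "(\<Sum>b<N. if [a * b = \<tau>] (mod N) then 1 else 0) = \<psi> a ^ 2" by blast+
qed

text \<open>The squares of the numbers \<open>1 + j N\<close> are prime to \<open>N\<close> and each
  contributes at least \<open>1 / (1 + j N)\<close>, so the sum dominates a multiple of the harmonic
  series.\<close>

lemma weighted_divisor_sum_unbounded:
  "\<exists>M. B < (\<Sum>m\<in>{0<..M^2}. \<psi> m ^ 2 * divisor_sum m / sqrt m)"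
proof -
  have "filterlim (harm :: nat \<Rightarrow> real) at_top sequentially" by (rule harm_at_top)
  then have "eventually (\<lambda>J. N * \<bar>B\<bar> + 1 \<le> (harm J :: real)) sequentially"
    by (simp add: filterlim_at_top)
  then obtain J where J: "N * \<bar>B\<bar> + 1 \<le> (harm J :: real)" by (auto simp: eventually_sequentially)
  \<comment> \<open>As \<open>1 + j N \<le> J N\<close> for \<open>j < J\<close>, the range up to
    \<open>M^2\<close> contains all the chosen squares.\<close>
  let ?M = "J * N" and ?h = "\<lambda>j. (1 + j * N)^2"
  have "N * B \<le> N * \<bar>B\<bar>" by (intro mult_left_mono) auto
  with J have "N * B < harm J" by linarith
  then have "B < harm J / N" using modulus_pos by (simp add: field_simps)
  also have "harm J / N = (\<Sum>j<J. 1 / (N * Suc j))"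
    unfolding harm_altdef sum_divide_distrib
    by (intro sum.cong refl) (simp only: of_nat_mult inverse_eq_divide divide_divide_eq_left mult.commute[of "real N"])
  also have "\<dots> \<le> (\<Sum>j<J. \<psi> (?h j) ^ 2 * divisor_sum (?h j) / sqrt (?h j))"
  proof (intro sum_mono)
    fix j
    have "coprime (1 + j * N) N"
      by (rule coprimeI) (metis dvd_add_left_iff dvd_mult)
    then have "coprime (?h j) N" by simp
    then have "\<psi> (?h j) ^ 2 = 1" by (simp only: square if_True)
    moreover have "1 / real (N * Suc j) \<le> 1 / real (1 + j * N)"
      using modulus_pos by (intro divide_left_mono) (auto simp: algebra_simps simp flip: of_nat_mult of_nat_add)
    moreover have "1 / real (1 + j * N) \<le> divisor_sum (?h j) / real (1 + j * N)"
      using divisor_sum_square[of "1 + j * N"] by (intro divide_right_mono) auto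
    ultimately show "1 / real (N * Suc j) \<le> \<psi> (?h j) ^ 2 * divisor_sum (?h j) / sqrt (?h j)"
      by (simp add: real_sqrt_power[symmetric] del: of_nat_mult of_nat_add of_nat_Suc mult_Suc mult_Suc_right)
  qed
  also have "\<dots> = (\<Sum>m\<in>?h ` {..<J}. \<psi> m ^ 2 * divisor_sum m / sqrt m)"
    using modulus_pos by (subst sum.reindex) (auto simp: inj_on_def power2_eq_iff_nonneg)
  also have "\<dots> \<le> (\<Sum>m\<in>{0<..?M^2}. \<psi> m ^ 2 * divisor_sum m / sqrt m)"
  proof (intro sum_mono2)
    show "?h ` {..<J} \<subseteq> {0<..?M^2}"
    proof
      fix m assume "m \<in> ?h ` {..<J}"
      then obtain j where j: "j < J" "m = ?h j" by auto
      have "1 + j * N \<le> Suc j * N" using modulus_pos by simp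
      also have "\<dots> \<le> J * N" using j by (intro mult_right_mono) auto
      finally show "m \<in> {0<..?M^2}" using j by (simp add: power_mono del: mult_Suc)
    qed
    fix m assume "m \<in> {0<..?M^2} - ?h ` {..<J}"
    then show "0 \<le> \<psi> m ^ 2 * divisor_sum m / sqrt m" using divisor_sum_nonneg[of m] by simp
  qed simp
  finally show ?thesis by blast
qed

text \<open>The function \<open>K\<close> of the proof has mean value \<open>0\<close> in each variable, so its weighted sum over the
  hyperbola region stays bounded.  This transfers the divergence of the sum of
  \<open>divisor_sum m / sqrt m\<close> over all \<open>m\<close> prime to \<open>N\<close>, which already the squares cause, to each residue
  class on which \<open>\<psi>\<close> is \<open>1\<close>.  Non-vanishing of \<open>L(1, \<psi>)\<close> is not needed.\<close>

theorem positive_divisor_sum_in_residue_class: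
  assumes u: "\<psi> u = -1" and \<tau>: "coprime \<tau> N" "\<psi> \<tau> = 1"
  obtains m where "0 < m" "[m = \<tau>] (mod N)" "0 < divisor_sum m"
proof (rule ccontr)
  assume "\<not> thesis"
  with that have nonpos: "0 < m \<Longrightarrow> [m = \<tau>] (mod N) \<Longrightarrow> divisor_sum m \<le> 0" for m
    by (meson not_le_imp_less)
  define \<phi> where "\<phi> = (\<Sum>i<N. \<psi> i ^ 2)"
  have "0 < \<phi>"
  proof -
    have "\<psi> (\<tau> mod N) ^ 2 = 1" using \<tau> by (simp add: reduce_mod)
    moreover have "\<psi> (\<tau> mod N) ^ 2 \<le> \<phi>" unfolding \<phi>_def
      by (rule member_le_sum) (use modulus_pos in auto)
    ultimately show ?thesis by simp
  qed
  define c where "c = 1 / real_of_int \<phi>"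
  have c: "0 < c" "c * \<phi> = 1" using \<open>0 < \<phi>\<close> by (simp_all add: c_def)
  define P where "P = (\<lambda>a b. (if [a * b = \<tau>] (mod N) then \<psi> b else 0))"
  \<comment> \<open>Summed over \<open>b\<close>, the first correction term vanishes and the second
    gives \<open>c * \<phi> * \<psi> a = \<psi> a\<close>, the corresponding sum of
    \<open>P\<close>. Over \<open>a\<close> the two terms exchange roles.\<close>
  define K where "K = (\<lambda>a b. P a b - c * (\<psi> a ^ 2 * \<psi> b + \<psi> a * \<psi> b ^ 2))"
  have P: "P (a + N) b = P a b" "P a (b + N) = P a b" for a b
    unfolding P_def periodic by (simp_all add: cong_def distrib_left distrib_right)
  have zero: "(\<Sum>i<N. real_of_int (\<psi> i)) = 0" using sum_eq_zero[OF u] by (metis of_int_0 of_int_sum)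
  have phi: "(\<Sum>i<N. real_of_int (\<psi> i) ^ 2) = \<phi>" by (simp add: \<phi>_def)
  have K1: "(\<Sum>b<N. K a b) = 0" for a
  proof -
    have "(\<Sum>b<N. K a b) = real_of_int (\<Sum>b<N. P a b) - c * (\<psi> a ^ 2 * (\<Sum>i<N. real_of_int (\<psi> i)) + \<psi> a * (\<Sum>i<N. real_of_int (\<psi> i) ^ 2))"
      unfolding K_def by (simp add: sum_subtractf sum.distrib sum_distrib_left distrib_left)
    also have "(\<Sum>b<N. P a b) = \<psi> a" unfolding P_def by (rule sum_residue_class(1)[OF \<tau>])
    finally have "(\<Sum>b<N. K a b) = \<psi> a - \<psi> a * (c * \<phi>)" unfolding zero phi by simp
    then show ?thesis using c by simp
  qed
  have K2: "(\<Sum>a<N. K a b) = 0" for b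
  proof -
    have "(\<Sum>a<N. K a b) = real_of_int (\<Sum>a<N. P a b) - c * ((\<Sum>i<N. real_of_int (\<psi> i) ^ 2) * \<psi> b + (\<Sum>i<N. real_of_int (\<psi> i)) * \<psi> b ^ 2)"
      unfolding K_def by (simp add: sum_subtractf sum.distrib sum_distrib_left sum_distrib_right distrib_left)
    also have "(\<Sum>a<N. P a b) = \<psi> b * (\<Sum>a<N. if [b * a = \<tau>] (mod N) then 1 else 0)"
      unfolding P_def by (simp add: sum_distrib_left mult.commute if_distrib cong: if_cong)
    also have "\<dots> = \<psi> b" using sum_residue_class(2)[OF \<tau>, of b] value_cases[of b] by auto
    finally have "(\<Sum>a<N. K a b) = \<psi> b - \<psi> b * (c * \<phi>)" unfolding zero phi by simp
    then show ?thesis using c by simp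
  qed
  have bd: "\<bar>K a b\<bar> \<le> 1 + 2 * c" for a b
  proof -
    have "\<bar>real_of_int (P a b)\<bar> \<le> 1" using value_cases[of b] by (auto simp: P_def)
    moreover have "\<bar>real_of_int (\<psi> a ^ 2 * \<psi> b + \<psi> a * \<psi> b ^ 2)\<bar> \<le> 2"
      using value_cases[of a] value_cases[of b] by auto
    then have "\<bar>c * real_of_int (\<psi> a ^ 2 * \<psi> b + \<psi> a * \<psi> b ^ 2)\<bar> \<le> c * 2"
      using c unfolding abs_mult by (intro mult_mono) auto
    ultimately show ?thesis unfolding K_def by (simp only: of_int_add of_int_mult of_int_power)
  qed
  define B where "B = N * (N * (1 + 2 * c)) + 4 * (N * (1 + 2 * c))"
  have B: "\<bar>\<Sum>(a, b)\<in>hyperbola_region (M^2). K a b / (sqrt a * sqrt b)\<bar> \<le> B" for M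
    unfolding B_def by (rule hyperbola_sum_bound[OF modulus_pos _ _ K2 K1 bd]) (simp_all add: K_def P periodic)
  \<comment> \<open>Collecting the pairs by their product \<open>m\<close> turns the
    \<open>P\<close>-part into a sum of \<open>divisor_sum m\<close> over the residue class, where
    the assumption to be refuted applies.\<close>
  have main: "(\<Sum>(a, b)\<in>hyperbola_region x. P a b / (sqrt a * sqrt b)) \<le> 0" for x
  proof -
    have "(\<Sum>(a, b)\<in>hyperbola_region x. P a b / (sqrt a * sqrt b))
      = (\<Sum>(a, b)\<in>hyperbola_region x. (\<lambda>m b. (if [m = \<tau>] (mod N) then \<psi> b else 0) / sqrt m) (a * b) b)"
      by (simp add: P_def real_sqrt_mult)
    also have "\<dots> = (\<Sum>m\<in>{0<..x}. \<Sum>b | b dvd m. (if [m = \<tau>] (mod N) then \<psi> b else 0) / sqrt m)"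
      by (rule sum_hyperbola_region_divisors)
    also have "\<dots> = (\<Sum>m\<in>{0<..x}. (if [m = \<tau>] (mod N) then divisor_sum m / sqrt m else 0))"
      by (intro sum.cong) (auto simp: divisor_sum_def sum_divide_distrib)
    also have "\<dots> \<le> 0" using nonpos by (intro sum_nonpos) (auto simp: divide_nonpos_nonneg)
    finally show ?thesis .
  qed
  define E where "E = (\<lambda>x. \<Sum>m\<in>{0<..x}. \<psi> m ^ 2 * divisor_sum m / sqrt m)"
  have E1: "(\<Sum>(a, b)\<in>hyperbola_region x. \<psi> a ^ 2 * \<psi> b / (sqrt a * sqrt b)) = E x" for x
  proof -
    \<comment> \<open>Since \<open>\<psi> b\<close> is its own cube, the coefficient depends on
      \<open>a\<close> only through the product \<open>a b\<close>, and the sum can be regrouped by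
      divisors.\<close>
    have *: "\<psi> a ^ 2 * \<psi> b = \<psi> (a * b) ^ 2 * \<psi> b" for a b
      using value_cases[of a] value_cases[of b] by (auto simp: mult)
    have "(\<Sum>(a, b)\<in>hyperbola_region x. \<psi> a ^ 2 * \<psi> b / (sqrt a * sqrt b))
      = (\<Sum>(a, b)\<in>hyperbola_region x. (\<lambda>m b. (\<psi> m ^ 2 * \<psi> b) / sqrt m) (a * b) b)"
      by (intro sum.cong refl, unfold case_prod_unfold, subst *, simp add: real_sqrt_mult)
    also have "\<dots> = (\<Sum>m\<in>{0<..x}. \<Sum>b | b dvd m. (\<psi> m ^ 2 * \<psi> b) / sqrt m)"
      by (rule sum_hyperbola_region_divisors)
    also have "\<dots> = E x"
      by (simp add: E_def divisor_sum_def sum_divide_distrib sum_distrib_left)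
    finally show ?thesis .
  qed
  have E2: "(\<Sum>(a, b)\<in>hyperbola_region x. \<psi> a * \<psi> b ^ 2 / (sqrt a * sqrt b)) = E x" for x
  proof -
    have "(\<Sum>(a, b)\<in>hyperbola_region x. \<psi> a * \<psi> b ^ 2 / (sqrt a * sqrt b)) =
      (\<Sum>(a, b)\<in>hyperbola_region x. \<psi> a ^ 2 * \<psi> b / (sqrt a * sqrt b))"
      by (rule sum.reindex_bij_witness[where i = "\<lambda>(a, b). (b, a)" and j = "\<lambda>(a, b). (b, a)"])
        (auto simp: hyperbola_region_def mult.commute)
    then show ?thesis using E1 by simp
  qed
  obtain M where M: "B / (2 * c) < E (M^2)"
    using weighted_divisor_sum_unbounded[of "B / (2 * c)"] by (auto simp: E_def)
  have "(\<Sum>(a, b)\<in>hyperbola_region (M^2). K a b / (sqrt a * sqrt b)) =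
     (\<Sum>(a, b)\<in>hyperbola_region (M^2). P a b / (sqrt a * sqrt b))
     - c * ((\<Sum>(a, b)\<in>hyperbola_region (M^2). \<psi> a ^ 2 * \<psi> b / (sqrt a * sqrt b))
         + (\<Sum>(a, b)\<in>hyperbola_region (M^2). \<psi> a * \<psi> b ^ 2 / (sqrt a * sqrt b)))"
    unfolding K_def case_prod_unfold
    by (simp add: diff_divide_distrib add_divide_distrib sum_subtractf sum.distrib sum_distrib_left distrib_left)
  with main[of "M^2"] E1 E2 have "(\<Sum>(a, b)\<in>hyperbola_region (M^2). K a b / (sqrt a * sqrt b)) \<le> - (2 * c * E (M^2))"
    by simp
  moreover have "B < 2 * c * E (M^2)" using M c by (simp add: field_simps)
  ultimately show False using B[of M] by linarith
qed

end

section \<open>Reciprocity\<close>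

lemma Legendre_cases: "Legendre a p \<in> {-1, 0, 1}"
  by (simp add: Legendre_def)

lemma sign_eq_if_cong:
  fixes x y :: int and p :: nat
  assumes "x \<in> {-1, 0, 1}" "y \<in> {-1, 0, 1}" "2 < p" "[x = y] (mod int p)"
  shows "x = y"
proof -
  have dvd: "int p dvd x - y" using assms(4) by (simp add: cong_iff_dvd_diff)
  have "\<bar>x - y\<bar> \<le> 2" using assms(1,2) by (elim insertE emptyE) simp_all
  show ?thesis
  proof (rule ccontr)
    assume "x \<noteq> y"
    then have "\<bar>int p\<bar> \<le> \<bar>x - y\<bar>" using dvd by (intro dvd_imp_le_int) auto
    with \<open>\<bar>x - y\<bar> \<le> 2\<close> assms(3) show False by linarith
  qed
qed

lemma Legendre_cong:
  assumes "[a = b] (mod p)" shows "Legendre a p = Legendre b p"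
proof -
  have "[x = a] (mod p) \<longleftrightarrow> [x = b] (mod p)" for x
    using assms cong_trans cong_sym by blast
  moreover have "[a = 0] (mod p) \<longleftrightarrow> [b = 0] (mod p)"
    using assms cong_trans cong_sym by blast
  ultimately show ?thesis by (simp add: Legendre_def QuadRes_def)
qed

lemma Legendre_mult:
  fixes p :: nat
  assumes "prime p" "2 < p"
  shows "Legendre (a * b) p = Legendre a p * Legendre b p"
proof (rule sign_eq_if_cong)
  show "Legendre a (int p) * Legendre b (int p) \<in> {- 1, 0, 1}"
    using Legendre_cases[of a p] Legendre_cases[of b p] by auto
  have "[Legendre a p * Legendre b p = a ^ ((p - 1) div 2) * b ^ ((p - 1) div 2)] (mod p)"
    by (intro cong_mult euler_criterion assms)
  moreover have "[Legendre (a * b) p = a ^ ((p - 1) div 2) * b ^ ((p - 1) div 2)] (mod p)"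
    using euler_criterion[OF assms, of "a * b"] by (simp add: power_mult_distrib)
  ultimately show "[Legendre (a * b) p = Legendre a p * Legendre b p] (mod int p)"
    by (metis cong_sym cong_trans)
qed (use assms Legendre_cases in auto)

lemma Legendre_1: "prime (p :: nat) \<Longrightarrow> Legendre 1 p = 1"
  by (auto simp: Legendre_def QuadRes_def cong_iff_dvd_diff intro: exI[of _ 1] dest: prime_gt_1_nat)

lemma Legendre_prod:
  fixes p :: nat
  assumes "prime p" "2 < p"
  shows "Legendre (\<Prod>i\<in>I. f i) p = (\<Prod>i\<in>I. Legendre (f i) p)"
proof (induction I rule: infinite_finite_induct)
  case (insert x F)
  have "Legendre (f x * prod f F) p = Legendre (f x) p * Legendre (prod f F) p"
    by (rule Legendre_mult[OF assms])
  with insert show ?case by simp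
qed (simp_all add: Legendre_1 assms(1))

lemma Legendre_nonzero:
  fixes p a :: nat
  assumes "prime p" shows "Legendre a p \<noteq> 0 \<longleftrightarrow> coprime a p"
proof -
  have "coprime a p \<longleftrightarrow> \<not> p dvd a"
    using assms by (metis coprime_absorb_left coprime_commute not_prime_unit prime_imp_coprime)
  then show ?thesis by (simp add: Legendre_def cong_0_iff)
qed

text \<open>The Kronecker symbol $(-4/m)$, for odd \<open>m\<close>.\<close>

definition minus_one_sign :: "nat \<Rightarrow> int" where
  "minus_one_sign m = (if m mod 4 = 3 then -1 else 1)"

lemma odd_mod_4: "odd m \<Longrightarrow> m mod 4 = 1 \<or> m mod 4 = (3::nat)"
  by presburger

lemma minus_one_sign_mult:
  assumes "odd a" "odd b"
  shows "minus_one_sign (a * b) = minus_one_sign a * minus_one_sign b"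
proof -
  have "a * b mod 4 = (a mod 4) * (b mod 4) mod 4" by (simp add: mod_mult_eq)
  with odd_mod_4[OF assms(1)] odd_mod_4[OF assms(2)] show ?thesis
    by (auto simp: minus_one_sign_def)
qed

lemma Legendre_minus_one:
  fixes p :: nat
  assumes "prime p" "2 < p"
  shows "Legendre (-1) p = minus_one_sign p"
proof (rule sign_eq_if_cong)
  have "odd p" using assms prime_odd_nat by blast
  then have "p mod 4 = 3 \<longleftrightarrow> odd ((p - 1) div 2)" by presburger
  then have "(-1) ^ ((p - 1) div 2) = minus_one_sign p" by (simp add: minus_one_sign_def)
  with euler_criterion[OF assms, of "-1"] show "[Legendre (- 1) (int p) = minus_one_sign p] (mod int p)"
    by simp
qed (use assms Legendre_cases in \<open>auto simp: minus_one_sign_def\<close>)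

text \<open>Gauss's lemma: for \<open>1 \<le> x \<le> h\<close> the numbers \<open>2 x\<close> stay
  below \<open>p\<close>, and they exceed \<open>h\<close> exactly for \<open>x > h div 2\<close>.
  The sign is the parity of \<open>h - h div 2\<close>.\<close>

lemma Legendre_two:
  fixes p :: nat
  assumes "prime p" "2 < p"
  shows "Legendre 2 p = (if p mod 8 = 1 \<or> p mod 8 = 7 then 1 else -1)"
proof -
  have odd: "odd p" using assms prime_odd_nat by blast
  interpret GAUSS p 2
    by unfold_locales (use assms in \<open>auto simp: cong_0_iff dest: zdvd_imp_le\<close>)
  define h where "h = (int p - 1) div 2"
  have p: "int p = 2 * h + 1" using odd unfolding h_def by presburger
  have "C = B"
  proof -
    have "x mod int p = x" if "x \<in> B" for x
      using that p by (auto simp: B_def A_def h_def[symmetric])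
    then show ?thesis unfolding C_def by simp
  qed
  then have "E = (\<lambda>x. x * 2) ` {h div 2<..h}"
    by (auto simp: E_def B_def A_def h_def[symmetric])
  then have "card E = nat (h - h div 2)"
    by (simp add: card_image inj_on_def)
  moreover have "even (nat (h - h div 2)) \<longleftrightarrow> p mod 8 = 1 \<or> p mod 8 = 7"
  proof -
    have "0 \<le> h" using p assms by simp
    then have "even (nat (h - h div 2)) \<longleftrightarrow> even (h - h div 2)" by (simp add: even_nat_iff)
    also have "\<dots> \<longleftrightarrow> int p mod 8 = 1 \<or> int p mod 8 = 7" unfolding p by presburger
    also have "\<dots> \<longleftrightarrow> p mod 8 = 1 \<or> p mod 8 = 7" by presburger
    finally show ?thesis .
  qed
  ultimately show ?thesis using gauss_lemma by auto
qed

text \<open>For a prime \<open>l\<close>, the character of odd modulus \<open>m\<close> whose value at odd primes \<open>q \<noteq> l\<close> is the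
  Legendre symbol $(l/q)$.\<close>

definition prime_symbol :: "nat \<Rightarrow> nat \<Rightarrow> int" where
  "prime_symbol l m =
     (if l = 2 then if m mod 8 = 1 \<or> m mod 8 = 7 then 1 else -1
      else Legendre m l * (if l mod 4 = 3 then minus_one_sign m else 1))"

lemma prime_symbol_eq_Legendre:
  fixes l q :: nat
  assumes "prime l" "prime q" "2 < q" "l \<noteq> q"
  shows "prime_symbol l q = Legendre l q"
proof (cases "l = 2")
  case True
  then show ?thesis using Legendre_two assms by (simp add: prime_symbol_def)
next
  case False
  then have l: "2 < l" using assms(1) prime_ge_2_nat[of l] by simp
  have odd: "odd l" "odd q" using assms l prime_odd_nat by blast+
  have rec: "Legendre l q * Legendre q l = (-1) ^ ((l - 1) div 2 * ((q - 1) div 2))"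
    by (rule Quadratic_Reciprocity) (use assms l in auto)
  have *: "even ((l - 1) div 2) \<longleftrightarrow> l mod 4 \<noteq> 3" "even ((q - 1) div 2) \<longleftrightarrow> q mod 4 \<noteq> 3"
    using odd by presburger+
  have "(-1) ^ ((l - 1) div 2 * ((q - 1) div 2)) = (if l mod 4 = 3 then minus_one_sign q else 1)"
    using * by (auto simp: minus_one_sign_def minus_one_power_iff)
  with rec have eq: "Legendre l q * Legendre q l = (if l mod 4 = 3 then minus_one_sign q else 1)" by simp
  have "(if l mod 4 = 3 then minus_one_sign q else 1) \<noteq> 0" by (simp add: minus_one_sign_def)
  with eq have "Legendre q l * Legendre q l = 1" using Legendre_cases[of q l] by auto
  with eq show ?thesis using False by (simp add: prime_symbol_def flip: eq)
qed

lemma mod_mult_8_sign: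
  assumes "odd a" "odd (b::nat)"
  shows "(a * b mod 8 = 1 \<or> a * b mod 8 = 7) \<longleftrightarrow> ((a mod 8 = 1 \<or> a mod 8 = 7) \<longleftrightarrow> (b mod 8 = 1 \<or> b mod 8 = 7))"
proof -
  have "a * b mod 8 = (a mod 8) * (b mod 8) mod 8" by (simp add: mod_mult_eq)
  moreover have "a mod 8 \<in> {1, 3, 5, 7}" "b mod 8 \<in> {1, 3, 5, 7}"
    using assms unfolding insert_iff empty_iff by presburger+
  moreover have "(x * y mod 8 = 1 \<or> x * y mod 8 = 7) \<longleftrightarrow> ((x = 1 \<or> x = 7) \<longleftrightarrow> (y = 1 \<or> y = 7))"
    if "x \<in> {1, 3, 5, 7}" "y \<in> {1, 3, 5, 7}" for x y :: nat
    using that by (elim insertE emptyE) simp_all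
  ultimately show ?thesis by metis
qed

lemma prime_symbol_mult:
  assumes "prime l" "odd a" "odd b"
  shows "prime_symbol l (a * b) = prime_symbol l a * prime_symbol l b"
proof (cases "l = 2")
  case True
  then show ?thesis using mod_mult_8_sign[OF assms(2,3)] by (simp add: prime_symbol_def)
next
  case False
  then have "2 < l" using assms(1) prime_ge_2_nat[of l] by simp
  then show ?thesis using False assms
    by (simp add: prime_symbol_def Legendre_mult minus_one_sign_mult)
qed

lemma minus_one_sign_cong: "[a = b] (mod 4) \<Longrightarrow> minus_one_sign a = minus_one_sign b"
  by (simp add: minus_one_sign_def cong_def)

lemma prime_symbol_cong:
  assumes "[a = b] (mod 8 * l)"
  shows "prime_symbol l a = prime_symbol l b"
proof -
  have "[a = b] (mod 8)" "[a = b] (mod l)" "[a = b] (mod 4)"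
    using assms by (auto elim!: cong_dvd_modulus_nat)
  moreover have "Legendre a l = Legendre b l"
    by (rule Legendre_cong) (simp add: cong_int_iff \<open>[a = b] (mod l)\<close>)
  ultimately show ?thesis
    unfolding prime_symbol_def using minus_one_sign_cong[of a b] by (simp add: cong_def)
qed

lemma prime_symbol_values:
  assumes "prime l" "coprime a (8 * l)"
  shows "prime_symbol l a = 1 \<or> prime_symbol l a = -1"
proof -
  have "coprime a l" using assms(2) by simp
  with Legendre_nonzero[OF assms(1), of a] Legendre_cases[of a l]
  have "Legendre a l = 1 \<or> Legendre a l = -1" by blast
  then show ?thesis by (auto simp: prime_symbol_def minus_one_sign_def)
qed

text \<open>For odd \<open>l\<close>, the Legendre symbol of -1 and the reciprocity factor are both
  -1 if \<open>l mod 4 = 3\<close> and both 1 otherwise, so they cancel.\<close>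

lemma prime_symbol_of_minus_one:
  assumes "prime l" "[int m = -1] (mod l)" "m mod 4 = 3" "l = 2 \<Longrightarrow> m mod 8 = 7"
  shows "prime_symbol l m = 1"
proof (cases "l = 2")
  case False
  then have "2 < l" using assms(1) prime_ge_2_nat[of l] by simp
  with Legendre_minus_one[of l] Legendre_cong[OF assms(2)] assms False show ?thesis
    by (simp add: prime_symbol_def minus_one_sign_def)
qed (use assms in \<open>simp add: prime_symbol_def\<close>)

text \<open>Squaring sends 1 and \<open>p - 1\<close> to the same residue, so on a finite set it is
  not onto.\<close>

lemma exists_nonresidue:
  fixes p :: nat
  assumes "prime p" "2 < p"
  obtains c :: nat where "Legendre (int c) (int p) = -1"
proof -
  define f where "f = (\<lambda>x::nat. x^2 mod p)"
  have sub: "f ` {0<..<p} \<subseteq> {0<..<p}"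
    using assms(1) by (auto simp: f_def mod_greater_zero_iff_not_dvd prime_dvd_power_iff dest: nat_dvd_not_less)
  have "f 1 = f (p - 1)"
  proof -
    have "[int (p - 1) ^ 2 = 1] (mod int p)"
      using assms by (simp add: of_nat_diff cong_iff_dvd_diff power2_eq_square algebra_simps)
    then have "[(p - 1) ^ 2 = 1] (mod p)" by (metis cong_int_iff of_nat_1 of_nat_power)
    then show ?thesis by (simp add: f_def cong_def)
  qed
  then have "\<not> inj_on f {0<..<p}" using assms inj_onD[of f "{0<..<p}" 1 "p - 1"] by auto
  then have "f ` {0<..<p} \<noteq> {0<..<p}" using eq_card_imp_inj_on[of "{0<..<p}" f] by auto
  with sub obtain c where "c \<in> {0<..<p}" and c: "c \<notin> f ` {0<..<p}" by blast
  then have c: "0 < c" "c < p" "c \<notin> f ` {0<..<p}" by auto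
  have "\<not> [int c = 0] (mod int p)" using c by (auto simp: cong_0_iff dest: nat_dvd_not_less)
  moreover have "\<not> QuadRes p c"
  proof
    assume "QuadRes p c"
    then obtain y where y: "[y^2 = int c] (mod p)" by (auto simp: QuadRes_def)
    define x where "x = nat (y mod int p)"
    have x: "int x = y mod int p" using assms by (simp add: x_def)
    have "[int x ^ 2 = y ^ 2] (mod int p)" unfolding x by (simp add: cong_def power_mod)
    then have xc: "[x ^ 2 = c] (mod p)" using y by (metis cong_int_iff cong_trans of_nat_power)
    then have fx: "f x = c" using c by (simp add: f_def cong_def)
    have "x < p" using x assms by (simp add: x_def nat_less_iff)
    moreover have "x \<noteq> 0" using fx c by (intro notI) (simp add: f_def)
    ultimately show False using c fx by auto
  qed
  ultimately show thesis using that[of c] by (simp add: Legendre_def)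
qed

lemma sqrt_mod_prod_primes:
  fixes c :: int
  assumes "finite P" "\<And>q. q \<in> P \<Longrightarrow> prime q" "\<And>q. q \<in> P \<Longrightarrow> QuadRes (int q) c"
  shows "\<exists>y. [y^2 = c] (mod int (\<Prod>P))"
  using assms
proof (induction P rule: finite_induct)
  case (insert q P)
  then obtain y where y: "[y^2 = c] (mod int (\<Prod>P))" by blast
  from insert.prems obtain z where z: "[z^2 = c] (mod int q)" by (auto simp: QuadRes_def)
  have cop: "coprime (int q) (int (\<Prod>P))"
    using insert by (auto simp: coprime_commute intro!: prod_coprime_right primes_coprime)
  obtain x where x: "[x = z] (mod int q)" "[x = y] (mod int (\<Prod>P))"
    using binary_chinese_remainder_int[OF cop] by blast
  have "[x^2 = c] (mod int q)" "[x^2 = c] (mod int (\<Prod>P))"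
    using cong_pow[OF x(1), of 2] cong_pow[OF x(2), of 2] y z cong_trans by blast+
  then have "[x^2 = c] (mod int q * int (\<Prod>P))" using cop by (rule coprime_cong_mult)
  then show ?case using insert by auto
qed simp

lemma squarefree_eq_prod_primes:
  fixes n :: nat
  assumes "squarefree n" shows "n = \<Prod>(prime_factors n)"
proof -
  have "n \<noteq> 0" using assms by (intro notI) simp
  then have "n = (\<Prod>q\<in>prime_factors n. q ^ multiplicity q n)" by (intro prime_factorization_nat) simp
  also have "\<dots> = (\<Prod>q\<in>prime_factors n. q)"
  proof (rule prod.cong)
    fix q assume q: "q \<in> prime_factors n"
    then have "0 < multiplicity q n"
      using \<open>n \<noteq> 0\<close> by (auto simp: prime_multiplicity_gt_zero_iff in_prime_factors_iff)
    moreover have "multiplicity q n \<le> 1"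
      using squarefree_factorial_semiring''[OF \<open>n \<noteq> 0\<close>] assms q by auto
    ultimately have "multiplicity q n = 1" by simp
    then show "q ^ multiplicity q n = q" by simp
  qed simp
  finally show ?thesis .
qed

section \<open>The character attached to a squarefree number\<close>

lemma coprime_8_iff: "coprime (8 :: nat) n \<longleftrightarrow> odd n"
proof -
  have "(8 :: nat) = 2 ^ 3" by simp
  then show ?thesis by (simp only: coprime_power_left_iff coprime_left_2_iff_odd) simp
qed

lemma coprime_4_iff: "coprime (4 :: nat) n \<longleftrightarrow> odd n"
proof -
  have "(4 :: nat) = 2 ^ 2" by simp
  then show ?thesis by (simp only: coprime_power_left_iff coprime_left_2_iff_odd) simp
qed

text \<open>The Kronecker symbol $(-4k/m)$, for squarefree \<open>k\<close>.\<close>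

definition form_character :: "nat \<Rightarrow> nat \<Rightarrow> int" where
  "form_character k m = (if coprime m (8 * k)
     then minus_one_sign m * (\<Prod>l\<in>prime_factors k. prime_symbol l m) else 0)"

lemma quadratic_character_form_character:
  assumes "0 < k"
  shows "quadratic_character (8 * k) (form_character k)"
proof
  show "0 < 8 * k" using assms by simp
  have pr: "prime l" if "l \<in> prime_factors k" for l using that by auto
  fix a b
  show "form_character k (a * b) = form_character k a * form_character k b"
  proof (cases "coprime a (8 * k) \<and> coprime b (8 * k)")
    case True
    then have odd: "odd a" "odd b" by (simp_all add: coprime_8_iff coprime_commute[of _ 8])
    have "(\<Prod>l\<in>prime_factors k. prime_symbol l (a * b)) =
        (\<Prod>l\<in>prime_factors k. prime_symbol l a) * (\<Prod>l\<in>prime_factors k. prime_symbol l b)"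
      by (subst prod.distrib[symmetric], rule prod.cong) (use pr odd prime_symbol_mult in auto)
    then show ?thesis using True odd by (simp add: form_character_def minus_one_sign_mult)
  qed (auto simp: form_character_def)
  have "[a + 8 * k = a] (mod 8 * k)" by (simp add: cong_def)
  then have c: "[a + 8 * k = a] (mod 8 * l)" if "l dvd k" for l
    using that by (auto elim!: cong_dvd_modulus_nat)
  have "(\<Prod>l\<in>prime_factors k. prime_symbol l (a + 8 * k)) = (\<Prod>l\<in>prime_factors k. prime_symbol l a)"
    by (rule prod.cong[OF refl], rule prime_symbol_cong, rule c) auto
  moreover have "minus_one_sign (a + 8 * k) = minus_one_sign a"
    by (rule minus_one_sign_cong, rule cong_dvd_modulus_nat[OF c[of 1]]) simp_all
  moreover have "coprime (a + 8 * k) (8 * k) \<longleftrightarrow> coprime a (8 * k)"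
    by (rule coprime_cong_cong_left) (simp add: cong_def)
  ultimately show "form_character k (a + 8 * k) = form_character k a"
    by (simp add: form_character_def)
  show "form_character k a = 1 \<or> form_character k a = - 1" if "coprime a (8 * k)"
  proof -
    have "\<bar>prime_symbol l a\<bar> = 1" if "l \<in> prime_factors k" for l
    proof -
      have "l dvd k" using that by auto
      then have "8 * l dvd 8 * k" by simp
      then have "coprime a (8 * l)"
        using coprime_divisors[OF dvd_refl _ \<open>coprime a (8 * k)\<close>] by blast
      then show ?thesis using prime_symbol_values[of l a] pr[OF that] by auto
    qed
    then have "\<bar>\<Prod>l\<in>prime_factors k. prime_symbol l a\<bar> = 1" by (simp add: abs_prod)
    then have "\<bar>form_character k a\<bar> = 1"
      using that by (simp add: form_character_def abs_mult minus_one_sign_def)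
    then show ?thesis by linarith
  qed
  show "form_character k a = 0" if "\<not> coprime a (8 * k)"
    using that by (simp only: form_character_def if_False)
qed

lemma form_character_prime:
  assumes "squarefree k" "prime q" "coprime q (8 * k)"
  shows "form_character k q = Legendre (- int k) q"
proof -
  have q: "2 < q"
  proof -
    have "q \<noteq> 2" using assms(3) by (intro notI) simp
    then show ?thesis using prime_ge_2_nat[OF assms(2)] by simp
  qed
  have "prime_symbol l q = Legendre l q" if "l \<in> prime_factors k" for l
  proof (rule prime_symbol_eq_Legendre)
    have "l dvd k" using that by auto
    then show "l \<noteq> q" using assms(2,3) by (metis coprime_absorb_left coprime_mult_right_iff not_prime_unit)
  qed (use that assms q in auto)
  then have "form_character k q = Legendre (-1) q * (\<Prod>l\<in>prime_factors k. Legendre l q)"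
    using assms(3) Legendre_minus_one[OF assms(2) q] by (simp add: form_character_def)
  also have "\<dots> = Legendre (-1 * (\<Prod>l\<in>prime_factors k. int l)) q"
    by (simp only: Legendre_prod[OF assms(2) q] Legendre_mult[OF assms(2) q])
  also have "(\<Prod>l\<in>prime_factors k. int l) = int k"
    by (simp only: of_nat_prod[symmetric] squarefree_eq_prod_primes[OF assms(1), symmetric])
  finally show ?thesis by simp
qed

text \<open>The character is odd, as that of an imaginary quadratic field. This supplies the
  argument with value -1 on which the cancellation rests.\<close>

lemma form_character_minus_one:
  assumes "0 < k"
  shows "form_character k (8 * k - 1) = -1"
proof -
  let ?m = "8 * k - 1"
  have "coprime ?m (8 * k)" using coprime_diff_one_left_nat[of "8 * k"] assms by simp
  moreover have "?m mod 8 = 7 \<and> ?m mod 4 = 3"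
  proof -
    obtain j where "k = Suc j" using assms gr0_implies_Suc by blast
    then have "?m = 7 + 8 * j" by simp
    then show ?thesis by presburger
  qed
  moreover have "prime_symbol l ?m = 1" if "l \<in> prime_factors k" for l
  proof (rule prime_symbol_of_minus_one)
    have "l dvd k" using that by auto
    then have "int l dvd 8 * int k" by simp
    then show "[int ?m = -1] (mod l)" using assms by (simp add: cong_iff_dvd_diff of_nat_diff)
  qed (use that assms calculation in auto)
  ultimately show ?thesis by (simp add: form_character_def minus_one_sign_def)
qed

text \<open>At \<tau> the factor \<open>minus_one_sign\<close> is -1 and the factors at the primes
  of \<open>n\<close> are 1, so the factor at \<open>p\<close> has to be -1 for the product to be 1.
  An even \<open>n\<close> forces \<open>\<tau> mod 8 = 7\<close>, which is what the factor at 2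
  requires.\<close>

lemma exists_residue_class:
  fixes n p :: nat
  assumes "0 < n" "prime p" "coprime n p"
  obtains \<tau> where "[int \<tau> = -1] (mod 4 * n)" "coprime \<tau> (8 * (n * p))" "prime_symbol p \<tau> = -1"
    "even n \<Longrightarrow> \<tau> mod 8 = 7"
proof (cases "p = 2")
  case True
  then have "odd n" using assms(3) by simp
  then have "coprime (8::nat) n" by (simp add: coprime_8_iff)
  \<comment> \<open>The residue 3 is -1 modulo 4, yet its symbol for the prime 2 is -1; the other
    choice 7 would give 1.\<close>
  then obtain \<tau> where \<tau>: "[\<tau> = 3] (mod 8)" "[\<tau> = n - 1] (mod n)"
    using binary_chinese_remainder_nat by blast
  have n1: "[int \<tau> = -1] (mod n)"
  proof -
    have "[int \<tau> = int (n - 1)] (mod n)" using \<tau>(2) by (simp only: cong_int_iff)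
    also have "[int (n - 1) = -1] (mod n)" using assms(1) by (simp add: cong_iff_dvd_diff of_nat_diff)
    finally show ?thesis .
  qed
  moreover have "[int \<tau> = -1] (mod 4)"
  proof -
    have "\<tau> mod 8 = 3" using \<tau>(1) by (simp add: cong_def)
    then show ?thesis unfolding cong_def by presburger
  qed
  moreover have "coprime (4::int) (int n)"
    using \<open>odd n\<close> coprime_4_iff[of n] coprime_int_iff[of 4 n] by simp
  ultimately have c: "[int \<tau> = -1] (mod 4 * n)"
    using coprime_cong_mult[of "int \<tau>" "-1" 4 "int n"] by simp
  have "\<tau> mod 8 = 3" using \<tau>(1) by (simp add: cong_def)
  then have "prime_symbol p \<tau> = -1" "odd \<tau>" unfolding True prime_symbol_def by (simp, presburger)
  moreover have "coprime \<tau> n"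
  proof -
    have "coprime (int \<tau>) (int n)" using coprime_cong_cong_left[OF n1] by simp
    then show ?thesis by simp
  qed
  moreover have "coprime \<tau> 8" using \<open>odd \<tau>\<close> by (simp add: coprime_8_iff coprime_commute[of _ 8])
  moreover have "coprime \<tau> p" using \<open>odd \<tau>\<close> True by simp
  ultimately have "coprime \<tau> (8 * (n * p))" by (simp only: coprime_mult_right_iff simp_thms)
  with that[of \<tau>] c \<open>prime_symbol p \<tau> = -1\<close> \<open>odd n\<close> show thesis by simp
next
  case False
  then have p: "2 < p" using prime_ge_2_nat[OF assms(2)] by simp
  then have odd: "odd p" using assms(2) prime_odd_nat by blast
  \<comment> \<open>Because \<open>\<tau> mod 4 = 3\<close>, the reciprocity factor is already -1
    when \<open>p mod 4 = 3\<close>, and a residue is wanted; otherwise a nonresidue.\<close>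
  obtain c :: nat where c: "Legendre c p * (if p mod 4 = 3 then -1 else 1) = -1"
  proof (cases "p mod 4 = 3")
    case True
    then show thesis using that[of 1] Legendre_1[OF assms(2)] by simp
  next
    case False
    then show thesis using that exists_nonresidue[OF assms(2) p] by auto
  qed
  have "coprime (4 * n) p" using assms(3) odd by (simp add: coprime_4_iff)
  then obtain \<tau> where \<tau>: "[\<tau> = 4 * n - 1] (mod 4 * n)" "[\<tau> = c] (mod p)"
    using binary_chinese_remainder_nat by blast
  have n1: "[int \<tau> = -1] (mod 4 * n)"
  proof -
    have "[int \<tau> = int (4 * n - 1)] (mod int (4 * n))" using \<tau>(1) by (simp only: cong_int_iff)
    also have "[int (4 * n - 1) = -1] (mod int (4 * n))" using assms(1) by (simp add: cong_iff_dvd_diff of_nat_diff)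
    finally show ?thesis by simp
  qed
  have t4: "\<tau> mod 4 = 3"
  proof -
    have "[int \<tau> = -1] (mod 4)" using n1 by (rule cong_dvd_modulus) simp
    then show ?thesis unfolding cong_def by presburger
  qed
  have "Legendre \<tau> p = Legendre c p" using \<tau>(2) by (intro Legendre_cong) (simp add: cong_int_iff)
  then have s: "prime_symbol p \<tau> = -1"
    using c t4 False by (simp add: prime_symbol_def minus_one_sign_def split: if_splits)
  have "Legendre \<tau> p \<noteq> 0" using c \<open>Legendre \<tau> p = Legendre c p\<close> by auto
  then have "coprime \<tau> p" using Legendre_nonzero[OF assms(2)] by blast
  moreover have "coprime \<tau> n"
  proof -
    have "[int \<tau> = -1] (mod n)" using n1 by (rule cong_dvd_modulus) simp
    then have "coprime (int \<tau>) (int n)" using coprime_cong_cong_left[of "int \<tau>" "-1" "int n"] by simp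
    then show ?thesis by simp
  qed
  moreover have "coprime \<tau> 8"
  proof -
    have "odd \<tau>" using t4 by presburger
    then show ?thesis by (simp add: coprime_8_iff coprime_commute[of _ 8])
  qed
  moreover have "\<tau> mod 8 = 7" if "even n"
  proof -
    have "[int \<tau> = -1] (mod 8)"
      by (rule cong_dvd_modulus[OF n1]) (use that in \<open>auto elim!: evenE\<close>)
    then show ?thesis unfolding cong_def by presburger
  qed
  ultimately show thesis using that[of \<tau>] n1 s by simp
qed

lemma form_character_residue_class:
  assumes "prime p" "coprime n p" "0 < n"
    and "[int \<tau> = -1] (mod 4 * n)" "coprime \<tau> (8 * (n * p))" "prime_symbol p \<tau> = -1"
    "even n \<Longrightarrow> \<tau> mod 8 = 7"
  shows "form_character (n * p) \<tau> = 1"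
proof -
  have "[int \<tau> = -1] (mod 4)" using assms(4) by (rule cong_dvd_modulus) simp
  then have t4: "\<tau> mod 4 = 3" unfolding cong_def by presburger
  have "p \<notin> prime_factors n" using assms(1,2) by (auto simp: in_prime_factors_iff prime_imp_coprime)
  moreover have "prime_factors (n * p) = insert p (prime_factors n)"
    using assms by (auto simp: prime_factors_product prime_prime_factors)
  moreover have "prime_symbol l \<tau> = 1" if l: "l \<in> prime_factors n" for l
  proof (rule prime_symbol_of_minus_one)
    show "prime l" using l by auto
    show "[int \<tau> = - 1] (mod int l)" using assms(4) by (rule cong_dvd_modulus) (use l in auto)
    show "\<tau> mod 8 = 7" if "l = 2" using assms(7) l that by auto
  qed (fact t4)
  ultimately show ?thesis using assms(5,6) t4 by (simp add: form_character_def minus_one_sign_def)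
qed

theorem exists_binary_coefficient:
  fixes n p :: nat
  assumes n: "squarefree n" and p: "prime p" "coprime n p"
  obtains \<alpha> :: nat and h b :: int where "0 < \<alpha>" "coprime \<alpha> (8 * (n * p))"
    "[int \<alpha> = - (h^2)] (mod 4 * n)" "[b^2 = - int (n * p)] (mod \<alpha>)"
proof -
  have n0: "0 < n" using n by (intro Nat.gr0I) auto
  have p0: "0 < p" using p prime_gt_0_nat by blast
  have sq: "squarefree (n * p)"
    by (intro squarefree_mult_coprime n squarefree_prime p)
  let ?N = "8 * (n * p)" and ?\<psi> = "form_character (n * p)"
  interpret quadratic_character ?N ?\<psi>
    by (rule quadratic_character_form_character) (use n0 p0 in simp)
  obtain \<tau> where \<tau>: "[int \<tau> = -1] (mod 4 * n)" "coprime \<tau> ?N" "prime_symbol p \<tau> = -1"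
    "even n \<Longrightarrow> \<tau> mod 8 = 7"
    using exists_residue_class[OF n0 p] by blast
  have "?\<psi> (?N - 1) = -1" by (rule form_character_minus_one) (use n0 p0 in simp)
  moreover have "?\<psi> \<tau> = 1" by (rule form_character_residue_class) (use p n0 \<tau> in auto)
  ultimately obtain m where m: "0 < m" "[m = \<tau>] (mod ?N)" "0 < divisor_sum m"
    using positive_divisor_sum_in_residue_class \<tau>(2) by blast
  \<comment> \<open>The primes of the squarefree part are those of odd multiplicity in
    \<open>m\<close>, none of which has character value -1.\<close>
  define \<alpha> k where "\<alpha> = squarefree_part m" and "k = square_part m"
  have dec: "m = \<alpha> * k ^ 2" unfolding \<alpha>_def k_def by (rule squarefree_decompose)
  have "coprime m ?N" using coprime_cong_cong_left[OF m(2)] \<tau>(2) by blast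
  then have cop: "coprime \<alpha> ?N" "coprime k ?N" unfolding dec by simp_all
  have pos: "0 < \<alpha>" using m(1) dec by (intro Nat.gr0I) auto
  have "\<exists>y. [y^2 = - int (n * p)] (mod int (\<Prod>(prime_factors \<alpha>)))"
  proof (rule sqrt_mod_prod_primes)
    fix q assume "q \<in> prime_factors \<alpha>"
    then have q: "prime q" "q dvd \<alpha>" by auto
    then have qN: "coprime q ?N" using coprime_divisors[OF _ dvd_refl cop(1)] by blast
    have "multiplicity q \<alpha> = multiplicity q m mod 2"
      unfolding \<alpha>_def using q(1) m(1) by (simp add: prime_multiplicity_squarefree_part)
    moreover have "0 < multiplicity q \<alpha>" using q pos by (simp add: prime_multiplicity_gt_zero_iff)
    ultimately have "odd (multiplicity q m)" by (simp add: odd_iff_mod_2_eq_one)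
    then have "?\<psi> q \<noteq> -1" using divisor_sum_even_multiplicity[OF m(3,1) q(1)] by blast
    then have "Legendre (- int (n * p)) q = 1"
      using coprime_values[OF qN] form_character_prime[OF sq q(1) qN] by simp
    then show "QuadRes (int q) (- int (n * p))" by (auto simp: Legendre_def split: if_splits)
  qed auto
  moreover have "\<Prod>(prime_factors \<alpha>) = \<alpha>"
    using squarefree_eq_prod_primes[of \<alpha>] by (simp add: \<alpha>_def)
  ultimately obtain b where b: "[b^2 = - int (n * p)] (mod \<alpha>)" by auto
  have "coprime (int k) (4 * int n)"
  proof -
    have "coprime k (4 * n)" using cop(2) by (simp add: coprime_commute[of k] coprime_4_iff coprime_8_iff)
    then have "coprime (int k) (int (4 * n))" by (simp only: coprime_int_iff)
    then show ?thesis by simp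
  qed
  then obtain j where j: "[int k * j = 1] (mod 4 * n)" using cong_solve_coprime_int[of "int k" "4 * int n"] by auto
  \<comment> \<open>Here \<open>\<alpha> k^2 = m\<close> is -1 modulo \<open>4 n\<close>, so the
    inverse \<open>j\<close> of \<open>k\<close> is the required square root.\<close>
  have "[int \<alpha> = - (j^2)] (mod 4 * n)"
  proof -
    have "[int m = int \<tau>] (mod int ?N)" using m(2) by (simp only: cong_int_iff)
    then have "[int m = int \<tau>] (mod 4 * n)" by (rule cong_dvd_modulus) simp
    then have m1: "[int m = -1] (mod 4 * n)" using \<tau>(1) by (rule cong_trans)
    have "[int \<alpha> * 1^2 = int \<alpha> * (int k * j)^2] (mod 4 * n)"
      by (intro cong_mult cong_pow cong_refl cong_sym[OF j])
    also have "int \<alpha> * (int k * j)^2 = int m * j^2" by (simp add: dec power_mult_distrib)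
    also have "[int m * j^2 = (-1) * j^2] (mod 4 * n)" using m1 by (rule cong_scalar_right)
    finally show ?thesis by simp
  qed
  then show thesis using that pos cop(1) b by blast
qed

section \<open>Forms of prime half-discriminant\<close>

text \<open>Sylvester's criterion by completing squares with denominators cleared, which keeps it
  valid over the integers as well as over the reals; both instances are used.\<close>

lemma ternary_form_pos:
  fixes a b c d e f x y z :: "'a :: linordered_idom"
  assumes "0 < a" "0 < 4 * a * b - f^2" "0 < 4 * a * b * c + d * e * f - a * d^2 - b * e^2 - c * f^2"
    and "(x, y, z) \<noteq> (0, 0, 0)"
  shows "0 < a * x^2 + b * y^2 + c * z^2 + d * y * z + e * x * z + f * x * y" (is "0 < ?Q")
proof -
  define al D where "al = 4 * a * b - f^2" and "D = 4 * a * b * c + d * e * f - a * d^2 - b * e^2 - c * f^2"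
  have pos: "0 < al" "0 < D" using assms by (simp_all add: al_def D_def)
  let ?L = "2 * a * x + f * y + e * z" and ?M = "al * y + (2 * a * d - e * f) * z"
  have eq: "4 * a * al * ?Q = al * ?L^2 + ?M^2 + 4 * a * D * z^2"
    by (simp add: al_def D_def algebra_simps power2_eq_square)
  have nonneg: "0 \<le> al * ?L^2" "0 \<le> ?M^2" "0 \<le> 4 * a * D * z^2" using assms(1) pos by simp_all
  have "0 < al * ?L^2 + ?M^2 + 4 * a * D * z^2"
  proof (cases "z = 0")
    case False
    then have "0 < 4 * a * D * z^2" using assms(1) pos by simp
    with nonneg show ?thesis by linarith
  next
    case z: True
    show ?thesis
    proof (cases "y = 0")
      case False
      then have "0 < ?M^2" using z pos by simp
      with nonneg show ?thesis by linarith
    next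
      case True
      then have "0 < al * ?L^2" using z assms(1,4) pos by simp
      with nonneg show ?thesis by linarith
    qed
  qed
  then have "0 < 4 * a * al * ?Q" unfolding eq .
  moreover have "0 < 4 * a * al" using assms(1) pos by simp
  ultimately show ?thesis by (simp only: zero_less_mult_pos)
qed

lemma pos_defI:
  assumes "0 < a" "0 < 4 * a * b - f^2" "0 < half_disc (Ternary a b c d e f)"
  shows "pos_def (Ternary a b c d e f)"
  unfolding pos_def_def
proof
  fix n assume "n \<in> nonzero_values (Ternary a b c d e f)"
  then obtain x y z where "n = value_at (Ternary a b c d e f) x y z" "(x, y, z) \<noteq> (0, 0, 0)"
    by (auto simp: nonzero_values_def)
  with ternary_form_pos[of a b f c d e x y z] assms show "0 < n" by simp
qed

lemma similar_swap_xz: "similar (Ternary c b a f e d) (Ternary a b c d e f)"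
  by (rule similar_substitution[where F = "\<lambda>x y z. z" and G = "\<lambda>x y z. y" and H = "\<lambda>x y z. x"
        and F' = "\<lambda>x y z. z" and G' = "\<lambda>x y z. y" and H' = "\<lambda>x y z. x"]) (auto simp: algebra_simps)

text \<open>Writing \<open>4 n Q = (2 n z + \<dots>)\<^sup>2 + G(x, y)\<close>, one needs a binary form \<open>G\<close> of determinant \<open>4 n p\<close>
  that is minus the square of a linear form modulo \<open>4 n\<close>; \<open>\<alpha>\<close> becomes its leading coefficient and
  \<open>2 b\<^sub>0\<close> half its middle one.\<close>

theorem exists_form_representing:
  fixes n p :: nat
  assumes n: "squarefree n" and p: "prime p" "coprime n p"
  obtains t where "pos_def t" "half_disc t = int p" "value_at t 0 0 1 = int n"
proof -
  have n0: "0 < n" using n by (intro Nat.gr0I) auto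
  have p0: "0 < p" using p prime_gt_0_nat by blast
  obtain \<alpha> :: nat and e b0 :: int where \<alpha>: "0 < \<alpha>" "coprime \<alpha> (8 * (n * p))"
    and e: "[int \<alpha> = - (e^2)] (mod 4 * n)" and b0: "[b0^2 = - int (n * p)] (mod \<alpha>)"
    using exists_binary_coefficient[OF n p] .
  obtain a where a: "int \<alpha> + e^2 = 4 * int n * a"
    using e by (auto simp: cong_iff_dvd_diff elim: dvdE)
  obtain g where g: "b0^2 + int n * int p = int \<alpha> * g"
    using b0 by (auto simp: cong_iff_dvd_diff elim: dvdE)
  have cop: "coprime (int \<alpha>) (int n)" using \<alpha>(2) by simp
  have "coprime e (int n)"
  proof (rule coprimeI)
    fix u assume u: "u dvd e" "u dvd int n"
    have "int \<alpha> = 4 * int n * a - e^2" using a by simp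
    moreover have "u dvd 4 * int n * a" "u dvd e^2" using u by (simp_all add: power2_eq_square)
    ultimately have "u dvd int \<alpha>" by (simp only: dvd_diff)
    then show "is_unit u" using u(2) cop by (meson coprime_common_divisor)
  qed
  then obtain i where i: "[e * i = 1] (mod int n)" using cong_solve_coprime_int[of e "int n"] by auto
  \<comment> \<open>The middle coefficient of \<open>G\<close> requires
    \<open>n f - d e = b0\<close>, so \<open>d\<close> has to make \<open>b0 + d e\<close> divisible
    by \<open>n\<close>.\<close>
  define d where "d = - b0 * i"
  have "int n dvd e * i - 1" using i by (simp add: cong_iff_dvd_diff)
  then obtain k where k: "e * i - 1 = int n * k" by (elim dvdE)
  have "b0 + d * e = - (b0 * (e * i - 1))" by (simp add: d_def algebra_simps)
  also have "\<dots> = int n * (- b0 * k)" by (simp add: k)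
  finally obtain f where f: "b0 + d * e = int n * f" by blast
  \<comment> \<open>The coefficient \<open>b\<close> needs \<open>n\<close> to divide
    \<open>g + d^2\<close>; this is checked after multiplication by \<alpha>, which is prime to
    \<open>n\<close>.\<close>
  have "int \<alpha> * (g + d^2) = int n * int p + (b0 + d * e) * (b0 - d * e) + d^2 * (int \<alpha> + e^2)"
    using g by (simp add: algebra_simps power2_eq_square)
  also have "\<dots> = int n * (int p + f * (b0 - d * e) + 4 * d^2 * a)"
    unfolding a f by (simp add: algebra_simps)
  finally have "int n dvd int \<alpha> * (g + d^2)" by simp
  then have "int n dvd g + d^2" using cop by (simp add: coprime_commute coprime_dvd_mult_right_iff)
  then obtain b where b: "g + d^2 = int n * b" by (elim dvdE)
  \<comment> \<open>For the moment \<open>n\<close> stands at \<open>x^2\<close>, where the minor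
    identities have their pivot; \<open>x\<close> and \<open>z\<close> are exchanged at the
    end.\<close>
  let ?t = "Ternary (int n) b a f e (2 * d)"
  have minor: "4 * int n * b - (2 * d)^2 = 4 * g"
    using b by (simp add: power_mult_distrib)
  have "0 < int \<alpha> * g" using n0 p0 unfolding g[symmetric] by (intro add_nonneg_pos) auto
  then have gpos: "0 < g" using \<alpha>(1) by (simp add: zero_less_mult_iff)
  have "4 * int n * half_disc ?t = (4 * g) * (4 * int n * a - e^2) - (2 * int n * f - e * (2 * d))^2"
    unfolding minor_determinant[symmetric] minor ..
  also have "4 * int n * a - e^2 = int \<alpha>" using a by simp
  also have "2 * int n * f - e * (2 * d) = 2 * b0"
    by (simp only: mult.assoc f[symmetric]) (simp add: algebra_simps)
  also have "(4 * g) * int \<alpha> - (2 * b0)^2 = 4 * int n * int p"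
    using g by (simp add: power_mult_distrib algebra_simps)
  finally have D: "half_disc ?t = int p" using n0 by simp
  have "pos_def ?t"
  proof (rule pos_defI)
    show "0 < 4 * int n * b - (2 * d)^2" unfolding minor using gpos by simp
    show "0 < half_disc ?t" unfolding D using p0 by simp
  qed (use n0 in simp)
  moreover have "similar (Ternary a b (int n) (2 * d) e f) ?t" by (rule similar_swap_xz)
  ultimately have "pos_def (Ternary a b (int n) (2 * d) e f)" by (rule pos_def_similar)
  moreover have "half_disc (Ternary a b (int n) (2 * d) e f) = int p"
    using D by (simp add: algebra_simps)
  ultimately show thesis by (rule that) simp
qed

text \<open>From \<open>4 \<beta>^2 \<le> \<alpha>^2 \<le> \<alpha> \<gamma>\<close> one gets
  \<open>3 \<alpha> \<gamma> \<le> 16 a D\<close>, and \<open>\<alpha> \<ge> 3 a^2\<close> removes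
  \<alpha>. The result controls the last coefficient \<open>c\<close>.\<close>

lemma reduced_gamma_bound:
  assumes "pos_def (Ternary a b c d e f)" "reduced (Ternary a b c d e f)"
  shows "9 * a * (4 * a * c - e^2) \<le> 16 * half_disc (Ternary a b c d e f)"
proof -
  define al be ga where "al = 4 * a * b - f^2" and "be = 2 * a * d - e * f" and "ga = 4 * a * c - e^2"
  have a: "0 < a" using pos_def_xx[OF assms(1)] .
  have r: "\<bar>2 * be\<bar> \<le> al" "al \<le> ga" using assms(2) by (auto simp: reduced_def al_def be_def ga_def)
  have al: "0 < al" using pos_def_minor[OF assms(1)] by (simp add: al_def)
  have "(2 * be)^2 \<le> al^2" using r(1) al by (metis abs_le_square_iff abs_of_pos)
  moreover have "al * al \<le> al * ga" using r(2) al by (intro mult_left_mono) auto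
  moreover have "al * ga - be^2 = 4 * a * half_disc (Ternary a b c d e f)"
    unfolding al_def be_def ga_def by (rule minor_determinant)
  ultimately have "3 * (al * ga) \<le> 16 * a * half_disc (Ternary a b c d e f)"
    by (simp add: power2_eq_square algebra_simps)
  moreover have "3 * a^2 * ga \<le> al * ga"
    using reduced_minor_bounds(1)[OF assms] r(2) al unfolding al_def by (intro mult_right_mono) auto
  ultimately have "a * (9 * a * ga) \<le> a * (16 * half_disc (Ternary a b c d e f))"
    by (simp add: power2_eq_square algebra_simps)
  then show ?thesis using a unfolding ga_def by (simp only: mult_le_cancel_left_pos)
qed

text \<open>Tuples are \<open>(a, b, c, d, e, f)\<close>, in the order of the half-discriminants 2,
  3, 5, 7, 11, 13, 17. The reduction conditions do not single out one form per class.\<close>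

definition reduced_table :: "(int \<times> int \<times> int \<times> int \<times> int \<times> int) list" where
  "reduced_table = [(1, 1, 1, 0, 1, 1), (1, 1, 1, 1, 1, 1), (1, 1, 1, -1, 0, 0), (1, 1, 1, 1, 0, 0),
     (1, 1, 1, 0, 0, 1), (1, 1, 2, 0, 1, 1), (1, 1, 2, 1, 1, 1), (1, 1, 2, -1, 0, 0), (1, 1, 2, 1, 0, 0),
     (1, 1, 2, 0, 1, 0), (1, 1, 3, -1, 0, 0), (1, 1, 3, 1, 0, 0), (1, 1, 3, 0, 1, 0), (1, 1, 4, 0, 1, 1),
     (1, 1, 4, 1, 1, 1), (1, 2, 2, -1, 0, 1), (1, 2, 2, 1, 0, 1), (1, 1, 6, 0, 1, 1), (1, 1, 6, 1, 1, 1),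
     (1, 2, 3, -1, 1, 1), (1, 2, 3, 2, 1, 1)]"

lemma reduced_table_complete:
  "list_all (\<lambda>a. list_all (\<lambda>b. list_all (\<lambda>e. list_all (\<lambda>f. list_all (\<lambda>d. list_all (\<lambda>c.
      if f \<le> a \<and> e \<le> a \<and> a \<le> b then
      if \<bar>2 * (2 * a * d - e * f)\<bar> \<le> 4 * a * b - f * f then
      if 4 * a * b - f * f \<le> 4 * a * c - e * e then
      if 4 * a * b * c + d * e * f - a * (d * d) - b * (e * e) - c * (f * f) \<in> set [2, 3, 5, 7, 11, 13, 17]
      then (a, b, c, d, e, f) \<in> set reduced_table else True else True else True else True)
    [1..7]) [-2..2]) [0..2]) [0..2]) [1..2]) [1..2]"
  by code_simp

lemma reduced_small_discriminant:
  assumes pd: "pos_def (Ternary a b c d e f)" and red: "reduced (Ternary a b c d e f)"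
    and D: "half_disc (Ternary a b c d e f) \<in> {2, 3, 5, 7, 11, 13, 17}"
  shows "(a, b, c, d, e, f) \<in> set reduced_table"
proof -
  have a0: "0 < a" using pos_def_xx[OF pd] .
  have r: "0 \<le> f" "f \<le> a" "0 \<le> e" "e \<le> a" "a \<le> b" "\<bar>2 * (2 * a * d - e * f)\<bar> \<le> 4 * a * b - f * f"
    "4 * a * b - f * f \<le> 4 * a * c - e * e"
    using red by (auto simp: reduced_def power2_eq_square)
  have ga: "9 * a * (4 * a * c - e * e) \<le> 16 * 17"
    using reduced_gamma_bound[OF pd red] D by (auto simp: power2_eq_square)
  have al: "3 * a^2 \<le> 4 * a * b - f * f"
    using reduced_minor_bounds(1)[OF pd red] by (simp add: power2_eq_square)
  \<comment> \<open>For \<open>a \<ge> 3\<close> the left side of \<open>ga\<close> would be at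
    least \<open>9 * 3 * 27 = 729\<close>, above \<open>16 * 17 = 272\<close>.\<close>
  have a2: "a \<le> 2"
  proof (rule ccontr)
    assume "\<not> a \<le> 2"
    then have "3 \<le> a" by simp
    then have "3 * 3 \<le> a * a" by (intro mult_mono) auto
    then have "27 \<le> 4 * a * c - e * e" using al r by (simp add: power2_eq_square)
    then have "9 * 3 * 27 \<le> 9 * a * (4 * a * c - e * e)" using \<open>3 \<le> a\<close> by (intro mult_mono) auto
    with ga show False by simp
  qed
  have cases: "a = 1 \<or> a = 2" using a0 a2 by auto
  have sq: "3 * (4 * a * b - f * f)^2 \<le> 16 * a * 17"
    using reduced_minor_bounds(2)[OF pd red] D a0 by (auto simp: power2_eq_square)
  \<comment> \<open>The squares of the minor are at most \<open>272 / 3 < 10^2\<close> for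
    \<open>a = 1\<close> and \<open>544 / 3 < 14^2\<close> for \<open>a \<le> 2\<close>.\<close>
  have al1: "4 * a * b - f * f < 10" if "a = 1"
    by (rule power2_less_imp_less) (use sq that in simp_all)
  have al2: "4 * a * b - f * f < 14"
    by (rule power2_less_imp_less) (use sq a2 in simp_all)
  have e2: "e \<in> {0, 1, 2}" "f \<in> {0, 1, 2}" using r cases by auto
  have b2: "b \<le> 2" using cases r al1 al2 e2 by (elim disjE) auto
  have d2: "- 2 \<le> d" "d \<le> 2" using cases r b2 e2 by (auto simp: abs_le_iff)
  have c7: "1 \<le> c" "c \<le> 7" using cases r ga e2 by auto
  have D': "4 * a * b * c + d * e * f - a * (d * d) - b * (e * e) - c * (f * f) \<in> set [2, 3, 5, 7, 11, 13, 17]"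
    using D by (simp add: power2_eq_square)
  have "a \<in> set [1..2]" "b \<in> set [1..2]" "e \<in> set [0..2]" "f \<in> set [0..2]" "d \<in> set [-2..2]" "c \<in> set [1..7]"
    using cases r b2 d2 c7 by auto
  from reduced_table_complete[unfolded list_all_iff, rule_format, OF this]
  show ?thesis by (simp only: r D' if_True simp_thms)
qed

section \<open>Comparing the values of forms of equal half-discriminant\<close>

lemma represented_of_double:
  assumes "value_at t x y z = 4 * n" "even x" "even y" "even z"
  shows "\<exists>x y z. value_at t x y z = n"
proof -
  obtain x' y' z' where "x = 2 * x'" "y = 2 * y'" "z = 2 * z'" using assms(2-4) by (elim evenE)
  then have "value_at t x y z = 4 * value_at t x' y' z'"
    by (cases t) (simp add: algebra_simps power2_eq_square)
  with assms(1) show ?thesis by auto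
qed

text \<open>The final alternative is meant for \<open>p = 17\<close>.\<close>

definition coprime_universal_form :: "nat \<Rightarrow> ternary" where
  "coprime_universal_form p =
     (if p = 2 then Ternary 1 1 1 1 1 1 else if p = 3 then Ternary 1 1 1 0 0 1
      else if p = 5 then Ternary 1 1 2 1 1 1 else if p = 7 then Ternary 1 1 2 0 1 0
      else if p = 11 then Ternary 1 1 3 1 0 0 else if p = 13 then Ternary 1 2 2 1 0 1
      else Ternary 1 2 3 2 1 1)"

text \<open>For \<open>p = 11\<close> and \<open>p = 17\<close> there is a second class of forms.  It contains no further values:
  for each of its vectors, one of three similarities of ratio \<open>4\<close> into the first class has an image
  that is divisible by \<open>2\<close>.\<close>

lemma second_class_11a:
  "\<exists>u v w. value_at (Ternary 1 1 3 1 0 0) u v w = value_at (Ternary 1 1 4 0 1 1) x y z"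
proof -
  \<comment> \<open>The three linear forms add up to an even number, so they cannot all be odd. Each
    case uses the similarity whose image is even when that form is.\<close>
  have "(even (y - z)) \<or> even x \<or> even (x - y + z)" by presburger
  then consider "even (y - z)" | "even x" | "even (x - y + z)" by blast
  then show ?thesis
  proof cases
    case 1
    show ?thesis by (rule represented_of_double[where x = "- 2 * x - y - z" and y = "- y - 3 * z" and z = "y - z"])
        (use 1 in \<open>auto simp: algebra_simps power2_eq_square\<close>)
  next
    case 2
    show ?thesis by (rule represented_of_double[where x = "- x - 2 * y" and y = "- 4 * z" and z = "- x"])
        (use 2 in \<open>auto simp: algebra_simps power2_eq_square\<close>)
  next
    case 3
    show ?thesis by (rule represented_of_double[where x = "- x + y - z" and y = "4 * z" and z = "- x - y - z"])
        (use 3 in \<open>auto simp: algebra_simps power2_eq_square\<close>)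
  qed
qed

lemma second_class_11b:
  "\<exists>u v w. value_at (Ternary 1 1 3 1 0 0) u v w = value_at (Ternary 1 1 4 1 1 1) x y z"
proof -
  have "(even (y - z)) \<or> even (x - z) \<or> even (x - y)" by presburger
  then consider "even (y - z)" | "even (x - z)" | "even (x - y)" by blast
  then show ?thesis
  proof cases
    case 1
    show ?thesis by (rule represented_of_double[where x = "- 2 * x - y - z" and y = "- y + 3 * z" and z = "y + z"])
        (use 1 in \<open>auto simp: algebra_simps power2_eq_square\<close>)
  next
    case 2
    show ?thesis by (rule represented_of_double[where x = "- x - 2 * y - z" and y = "- x + 3 * z" and z = "x + z"])
        (use 2 in \<open>auto simp: algebra_simps power2_eq_square\<close>)
  next
    case 3
    show ?thesis by (rule represented_of_double[where x = "- x + y" and y = "- 4 * z" and z = "- x - y"])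
        (use 3 in \<open>auto simp: algebra_simps power2_eq_square\<close>)
  qed
qed

lemma second_class_17a:
  "\<exists>u v w. value_at (Ternary 1 2 3 2 1 1) u v w = value_at (Ternary 1 1 6 0 1 1) x y z"
proof -
  have "(even (y - z)) \<or> even x \<or> even (x - y + z)" by presburger
  then consider "even (y - z)" | "even x" | "even (x - y + z)" by blast
  then show ?thesis
  proof cases
    case 1
    show ?thesis by (rule represented_of_double[where x = "- 2 * x - y + z" and y = "y - 3 * z" and z = "- y - z"])
        (use 1 in \<open>auto simp: algebra_simps power2_eq_square\<close>)
  next
    case 2
    show ?thesis by (rule represented_of_double[where x = "- x - 2 * y - 2 * z" and y = "- x + 2 * z" and z = "x + 2 * z"])
        (use 2 in \<open>auto simp: algebra_simps power2_eq_square\<close>)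
  next
    case 3
    show ?thesis by (rule represented_of_double[where x = "- x + y + z" and y = "- x - y - 3 * z" and z = "x + y - z"])
        (use 3 in \<open>auto simp: algebra_simps power2_eq_square\<close>)
  qed
qed

lemma second_class_17b:
  "\<exists>u v w. value_at (Ternary 1 2 3 2 1 1) u v w = value_at (Ternary 1 1 6 1 1 1) x y z"
proof -
  have "(even (y - z)) \<or> even (x - z) \<or> even (x - y)" by presburger
  then consider "even (y - z)" | "even (x - z)" | "even (x - y)" by blast
  then show ?thesis
  proof cases
    case 1
    show ?thesis by (rule represented_of_double[where x = "- 2 * x - y + z" and y = "- y - 3 * z" and z = "y - z"])
        (use 1 in \<open>auto simp: algebra_simps power2_eq_square\<close>)
  next
    case 2
    show ?thesis by (rule represented_of_double[where x = "- x - 2 * y + z" and y = "- x - 3 * z" and z = "x - z"])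
        (use 2 in \<open>auto simp: algebra_simps power2_eq_square\<close>)
  next
    case 3
    show ?thesis by (rule represented_of_double[where x = "- x + y - 2 * z" and y = "- x - y + 2 * z" and z = "x + y + 2 * z"])
        (use 3 in \<open>auto simp: algebra_simps power2_eq_square\<close>)
  qed
qed

lemma first_class:
  "value_at (Ternary 1 1 1 0 1 1) x y z = value_at (Ternary 1 1 1 1 1 1) (- y) z (x + y)"
  "value_at (Ternary 1 1 1 (- 1) 0 0) x y z = value_at (Ternary 1 1 1 0 0 1) (- y) z x"
  "value_at (Ternary 1 1 1 1 0 0) x y z = value_at (Ternary 1 1 1 0 0 1) z y x"
  "value_at (Ternary 1 1 2 0 1 1) x y z = value_at (Ternary 1 1 2 1 1 1) (- y) (x + y) z"
  "value_at (Ternary 1 1 2 (- 1) 0 0) x y z = value_at (Ternary 1 1 2 0 1 0) (- y) x z"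
  "value_at (Ternary 1 1 2 1 0 0) x y z = value_at (Ternary 1 1 2 0 1 0) y x z"
  "value_at (Ternary 1 1 3 (- 1) 0 0) x y z = value_at (Ternary 1 1 3 1 0 0) x (- y) z"
  "value_at (Ternary 1 1 3 0 1 0) x y z = value_at (Ternary 1 1 3 1 0 0) y x z"
  "value_at (Ternary 1 2 2 (- 1) 0 1) x y z = value_at (Ternary 1 2 2 1 0 1) x y (- z)"
  "value_at (Ternary 1 2 3 (- 1) 1 1) x y z = value_at (Ternary 1 2 3 2 1 1) (x + z) y (- z)"
  by (simp_all add: algebra_simps power2_eq_square)

lemma reduced_represented:
  assumes "(a, b, c, d, e, f) \<in> set reduced_table" "half_disc (Ternary a b c d e f) = int p"
  shows "\<exists>u v w. value_at (coprime_universal_form p) u v w = value_at (Ternary a b c d e f) x y z"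
proof -
  have refl: "\<exists>u v w. value_at t u v w = value_at t x y z" for t x y z by blast
  \<comment> \<open>Reading \<open>p\<close> off each entry as its half-discriminant makes all seven
    primes one finite conjunction.\<close>
  have "list_all (\<lambda>(a, b, c, d, e, f). \<forall>x y z. \<exists>u v w.
      value_at (coprime_universal_form (nat (half_disc (Ternary a b c d e f)))) u v w
        = value_at (Ternary a b c d e f) x y z) reduced_table"
    unfolding reduced_table_def list.pred_inject prod.case
    by (intro conjI allI TrueI, simp_all del: value_at.simps add: coprime_universal_form_def)
      (rule refl second_class_11a second_class_11b second_class_17a second_class_17b
        | intro exI, rule first_class[symmetric])+
  from bspec[OF this[unfolded list_all_iff] assms(1)] assms(2) show ?thesis by simp
qed

theorem coprime_universal_form_represents:
  fixes n p :: nat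
  assumes p: "p \<in> {2, 3, 5, 7, 11, 13, 17}" and n: "0 < n" "coprime n p"
  shows "\<exists>x y z. value_at (coprime_universal_form p) x y z = int n"
proof -
  define m k where "m = squarefree_part n" and "k = square_part n"
  have dec: "n = m * k ^ 2" unfolding m_def k_def by (rule squarefree_decompose)
  have sq: "squarefree m" by (simp add: m_def)
  have "prime p" using p by auto
  moreover have "coprime m p" using n(2) unfolding dec by simp
  ultimately obtain t where t: "pos_def t" "half_disc t = int p" "value_at t 0 0 1 = int m"
    using exists_form_representing[OF sq] by blast
  obtain s where s: "similar s t" "reduced s" using exists_reduced[OF t(1)] .
  obtain a b c d e f where s_eq: "s = Ternary a b c d e f" by (cases s)
  have pd: "pos_def s" using pos_def_similar[OF t(1) s(1)] .
  have D: "half_disc s = int p" using s(1) t(2) by (simp add: similar_def)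
  have "int m \<noteq> 0" by (simp add: m_def)
  then obtain x y z where xyz: "int m = value_at s x y z"
    using similar_represents[OF s(1) _ t(3)[symmetric]] by blast
  have "(a, b, c, d, e, f) \<in> set reduced_table"
  proof (rule reduced_small_discriminant)
    show "pos_def (Ternary a b c d e f)" "reduced (Ternary a b c d e f)"
      using pd s(2) by (simp_all only: s_eq)
    show "half_disc (Ternary a b c d e f) \<in> {2, 3, 5, 7, 11, 13, 17}"
      using D p unfolding s_eq by (elim insertE emptyE) simp_all
  qed
  then obtain u v w where uvw: "value_at (coprime_universal_form p) u v w = int m"
    using reduced_represented[of a b c d e f p x y z] D xyz unfolding s_eq by metis
  have "value_at (coprime_universal_form p) (int k * u) (int k * v) (int k * w)
      = int k ^ 2 * value_at (coprime_universal_form p) u v w"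
    by (cases "coprime_universal_form p") (simp add: algebra_simps power2_eq_square)
  also have "\<dots> = int n" unfolding uvw dec by (simp add: mult.commute)
  finally show ?thesis by blast
qed

section \<open>Real quadratic forms\<close>

definition real_form :: "ternary \<Rightarrow> real ^ 3 \<Rightarrow> real" where
  "real_form t v = (case t of Ternary a b c d e f \<Rightarrow>
     a * (v $ 1)^2 + b * (v $ 2)^2 + c * (v $ 3)^2 + d * v $ 2 * v $ 3 + e * v $ 1 * v $ 3 + f * v $ 1 * v $ 2)"

lemma real_form_of_int: "real_form t (\<chi> i. real_of_int (v $ i)) = value_at t (v $ 1) (v $ 2) (v $ 3)"
  by (cases t) (simp add: real_form_def)

lemma represents_real_form: "represents (real_form t) n \<longleftrightarrow> (\<exists>x y z. value_at t x y z = n)"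
proof -
  have "(\<exists>x y z. value_at t x y z = n) \<longleftrightarrow> (\<exists>v :: int ^ 3. value_at t (v $ 1) (v $ 2) (v $ 3) = n)"
  proof
    assume "\<exists>x y z. value_at t x y z = n"
    then obtain x y z where "value_at t x y z = n" by blast
    then have "value_at t ((vector [x, y, z] :: int ^ 3) $ 1) ((vector [x, y, z] :: int ^ 3) $ 2)
        ((vector [x, y, z] :: int ^ 3) $ 3) = n"
      by simp
    then show "\<exists>v :: int ^ 3. value_at t (v $ 1) (v $ 2) (v $ 3) = n" by blast
  qed blast
  then show ?thesis unfolding represents_def real_form_of_int by simp
qed

lemma integral_real_form: "integral_quadratic_form (real_form (Ternary a b c d e f))"
proof -
  define A :: "int ^ 3 ^ 3" where "A = vector [vector [2 * a, f, e], vector [f, 2 * b, d], vector [e, d, 2 * c]]"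
  have A: "A $ 1 $ 1 = 2 * a" "A $ 1 $ 2 = f" "A $ 1 $ 3 = e" "A $ 2 $ 1 = f" "A $ 2 $ 2 = 2 * b"
    "A $ 2 $ 3 = d" "A $ 3 $ 1 = e" "A $ 3 $ 2 = d" "A $ 3 $ 3 = 2 * c"
    by (simp_all add: A_def)
  have "transpose A = A" by (simp add: vec_eq_iff forall_3 transpose_def A)
  moreover have "\<forall>i. even (A $ i $ i)" by (simp add: forall_3 A)
  moreover have "real_form (Ternary a b c d e f) x = 1 / 2 * (x \<bullet> (map_matrix real_of_int A *v x))" for x
    by (simp add: real_form_def inner_vec_def matrix_vector_mult_def sum_3 A map_matrix_def
        power2_eq_square algebra_simps)
  ultimately show ?thesis unfolding integral_quadratic_form_def by blast
qed

lemma integral_form_is_real_form: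
  fixes Q :: "real ^ 3 \<Rightarrow> real"
  assumes "integral_quadratic_form Q" obtains t where "Q = real_form t"
proof -
  obtain A :: "int ^ 3 ^ 3" where A: "transpose A = A" "\<And>i. even (A $ i $ i)"
    "\<And>x. Q x = 1 / 2 * (x \<bullet> (map_matrix real_of_int A *v x))"
    using assms unfolding integral_quadratic_form_def by blast
  have sym: "A $ i $ j = A $ j $ i" for i j
  proof -
    have "transpose A $ i $ j = A $ j $ i" by (simp add: transpose_def)
    then show ?thesis by (simp only: A(1))
  qed
  obtain a b c where diag: "A $ 1 $ 1 = 2 * a" "A $ 2 $ 2 = 2 * b" "A $ 3 $ 3 = 2 * c"
    using A(2)[of 1] A(2)[of 2] A(2)[of 3] by (elim evenE)
  define d e f where "d = A $ 2 $ 3" and "e = A $ 1 $ 3" and "f = A $ 1 $ 2"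
  have off: "A $ 2 $ 3 = d" "A $ 1 $ 3 = e" "A $ 1 $ 2 = f" "A $ 3 $ 2 = d" "A $ 3 $ 1 = e" "A $ 2 $ 1 = f"
    unfolding d_def e_def f_def by (rule refl sym)+
  have "Q x = real_form (Ternary a b c d e f) x" for x
    unfolding A(3)
    by (simp add: real_form_def inner_vec_def matrix_vector_mult_def sum_3 diag off map_matrix_def
        power2_eq_square algebra_simps)
  then show thesis using that by blast
qed

lemma positive_definite_real_form:
  assumes "0 < a" "0 < 4 * a * b - f^2" "0 < half_disc (Ternary a b c d e f)"
  shows "positive_definite (real_form (Ternary a b c d e f))"
  unfolding positive_definite_def
proof (intro allI impI)
  fix v :: "real ^ 3"
  assume "v \<noteq> 0"
  then have "(v $ 1, v $ 2, v $ 3) \<noteq> (0, 0, 0)" by (auto simp: vec_eq_iff forall_3)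
  moreover have "0 < real_of_int a" using assms(1) by simp
  moreover have "0 < 4 * real_of_int a * real_of_int b - real_of_int f ^ 2"
    using assms(2) by (metis of_int_0_less_iff of_int_diff of_int_mult of_int_numeral of_int_power)
  moreover have "0 < 4 * real_of_int a * real_of_int b * real_of_int c + real_of_int d * real_of_int e * real_of_int f
      - real_of_int a * real_of_int d ^ 2 - real_of_int b * real_of_int e ^ 2 - real_of_int c * real_of_int f ^ 2"
  proof -
    have "0 < real_of_int (half_disc (Ternary a b c d e f))"
      using assms(3) by (simp only: of_int_0_less_iff)
    then show ?thesis
      by (simp only: half_disc.simps of_int_diff of_int_add of_int_mult of_int_power of_int_numeral)
  qed
  ultimately show "0 < real_form (Ternary a b c d e f) v"
    unfolding real_form_def ternary.case by (intro ternary_form_pos)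
qed

lemma pos_def_of_positive_definite:
  assumes "positive_definite (real_form t)" shows "pos_def t"
  unfolding pos_def_def
proof
  fix n assume "n \<in> nonzero_values t"
  then obtain x y z where n: "n = value_at t x y z" "(x, y, z) \<noteq> (0, 0, 0)"
    by (auto simp: nonzero_values_def)
  define v :: "int ^ 3" where "v = vector [x, y, z]"
  have v: "v $ 1 = x" "v $ 2 = y" "v $ 3 = z" by (simp_all add: v_def)
  have "(\<chi> i. real_of_int (v $ i)) \<noteq> (0 :: real ^ 3)"
    using n(2) v by (auto simp: vec_eq_iff forall_3)
  then have "0 < real_form t (\<chi> i. real_of_int (v $ i))"
    using assms unfolding positive_definite_def by blast
  then show "0 < n" unfolding real_form_of_int v n(1) by simp
qed

lemma no_coprime_universal_form:
  assumes "prime p" "p = 19 \<or> 37 \<le> p"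
  shows "\<not> (\<exists>Q :: real ^ 3 \<Rightarrow> real.
    integral_quadratic_form Q \<and> positive_definite Q \<and> coprime_universal p Q)"
proof
  assume "\<exists>Q :: real ^ 3 \<Rightarrow> real.
    integral_quadratic_form Q \<and> positive_definite Q \<and> coprime_universal p Q"
  then obtain Q :: "real ^ 3 \<Rightarrow> real" where
    Q: "integral_quadratic_form Q" "positive_definite Q" "coprime_universal p Q" by blast
  obtain t where t: "Q = real_form t" using integral_form_is_real_form[OF Q(1)] .
  have "pos_def t" using Q(2) unfolding t by (rule pos_def_of_positive_definite)
  from exists_unrepresented[OF this]
  obtain n where n: "n \<in> {1, 2, 3, 5, 6, 7, 10, 13, 14, 17, 21, 22, 23, 29, 31}"
    and no: "\<forall>x y z. value_at t x y z \<noteq> n"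
    by (rule bexE)
  \<comment> \<open>A listed \<open>n\<close> is at most 31, too small for
    \<open>p \<ge> 37\<close>, and none of them is a multiple of 19.\<close>
  have "\<not> int p dvd n"
  proof
    assume dvd: "int p dvd n"
    from n have "0 < n" "n \<le> 31" by auto
    then have "int p \<le> 31" using zdvd_imp_le[OF dvd] by simp
    with assms(2) have "p = 19" by auto
    from n dvd show False unfolding \<open>p = 19\<close> by (elim insertE emptyE) simp_all
  qed
  then have "coprime n (int p)"
    using assms(1) prime_imp_coprime[of "int p" n] by (simp add: coprime_commute)
  moreover have "0 < n" using n by auto
  ultimately have "represents Q n" using Q(3) by (simp add: coprime_universal_def)
  then show False using no unfolding t represents_real_form by blast
qed

lemma exists_coprime_universal_form:
  assumes "p \<in> {2, 3, 5, 7, 11, 13, 17}"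
  shows "\<exists>Q :: real ^ 3 \<Rightarrow> real.
    integral_quadratic_form Q \<and> positive_definite Q \<and> coprime_universal p Q"
proof (intro exI conjI)
  let ?Q = "real_form (coprime_universal_form p)"
  show "integral_quadratic_form ?Q"
    by (cases "coprime_universal_form p") (simp add: integral_real_form)
  show "positive_definite ?Q"
    using assms unfolding coprime_universal_form_def
    by (elim insertE emptyE) (simp_all add: positive_definite_real_form)
  show "coprime_universal p ?Q"
    unfolding coprime_universal_def represents_real_form
  proof (intro allI impI)
    fix n :: int
    assume n: "0 < n" "coprime n (int p)"
    then have "0 < nat n" "coprime (nat n) p" "int (nat n) = n"
      by (simp_all flip: coprime_int_iff)
    with coprime_universal_form_represents[OF assms, of "nat n"]
    show "\<exists>x y z. value_at (coprime_universal_form p) x y z = n" by simp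
  qed
qed

theorem theorem1p4:
  fixes p :: nat
  assumes "prime p"
  shows "(p = 19 \<or> p \<ge> 37 \<longrightarrow>
            \<not> (\<exists>Q :: real ^ 3 \<Rightarrow> real.
                 integral_quadratic_form Q \<and> positive_definite Q \<and> coprime_universal p Q))
       \<and> (p \<in> {2, 3, 5, 7, 11, 13, 17} \<longrightarrow>
            (\<exists>Q :: real ^ 3 \<Rightarrow> real.
                 integral_quadratic_form Q \<and> positive_definite Q \<and> coprime_universal p Q))
       \<and> (p = 23 \<longrightarrow>
            coprime_universal p (\<lambda>v :: real ^ 3. let x = v $ 1; y = v $ 2; z = v $ 3 in
                x ^ 2 + 2 * x * z + 2 * y ^ 2 + 3 * y * z + 5 * z ^ 2) \<longrightarrow>
            (\<exists>Q :: real ^ 3 \<Rightarrow> real.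
                 integral_quadratic_form Q \<and> positive_definite Q \<and> coprime_universal p Q))
       \<and> (p = 29 \<longrightarrow>
            coprime_universal p (\<lambda>v :: real ^ 3. let x = v $ 1; y = v $ 2; z = v $ 3 in
                x ^ 2 + x * z + 2 * y ^ 2 + 3 * y * z + 5 * z ^ 2) \<longrightarrow>
            (\<exists>Q :: real ^ 3 \<Rightarrow> real.
                 integral_quadratic_form Q \<and> positive_definite Q \<and> coprime_universal p Q))
       \<and> (p = 31 \<longrightarrow>
            coprime_universal p (\<lambda>v :: real ^ 3. let x = v $ 1; y = v $ 2; z = v $ 3 in
                x ^ 2 + 2 * x * z + 2 * y ^ 2 + y * z + 5 * z ^ 2) \<longrightarrow>
            (\<exists>Q :: real ^ 3 \<Rightarrow> real.
                 integral_quadratic_form Q \<and> positive_definite Q \<and> coprime_universal p Q))"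
proof -
  \<comment> \<open>These forms have half-discriminant \<open>p\<close> too, but no comparison with
    the other forms of that discriminant is made here, so representing each \<open>n\<close> by some
    form would not suffice.\<close>
  have 23: "(\<lambda>v :: real ^ 3. let x = v $ 1; y = v $ 2; z = v $ 3 in
      x ^ 2 + 2 * x * z + 2 * y ^ 2 + 3 * y * z + 5 * z ^ 2) = real_form (Ternary 1 2 5 3 2 0)"
    and 29: "(\<lambda>v :: real ^ 3. let x = v $ 1; y = v $ 2; z = v $ 3 in
      x ^ 2 + x * z + 2 * y ^ 2 + 3 * y * z + 5 * z ^ 2) = real_form (Ternary 1 2 5 3 1 0)"
    and 31: "(\<lambda>v :: real ^ 3. let x = v $ 1; y = v $ 2; z = v $ 3 in
      x ^ 2 + 2 * x * z + 2 * y ^ 2 + y * z + 5 * z ^ 2) = real_form (Ternary 1 2 5 1 2 0)"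
    by (simp_all add: fun_eq_iff real_form_def Let_def algebra_simps)
  have witness: "\<exists>Q :: real ^ 3 \<Rightarrow> real.
      integral_quadratic_form Q \<and> positive_definite Q \<and> coprime_universal p Q"
    if "coprime_universal p (real_form (Ternary a b c d e f))"
      "0 < a" "0 < 4 * a * b - f^2" "0 < half_disc (Ternary a b c d e f)" for a b c d e f
    using that integral_real_form positive_definite_real_form by blast
  show ?thesis
    unfolding 23 29 31
    by (intro conjI impI, erule no_coprime_universal_form[OF assms], erule exists_coprime_universal_form)
      (erule witness; simp)+
qed

end
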